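(* Let $m$ and $n$ be positive integers with $d = \gcd(m, n)$. Then every cycle on the $m \times n$ grid is uniquely determined by its signature if and only if $m$ and $n$ satisfy one or more of the following conditions: (a) $m \le 2$ or $n \le 2$; (b) $d = 1$; (c) $d = 2$ and $m \equiv n \equiv 2 \pmod 4$. Conversely, there exist two distinct cycles on the $m \times n$ grid with the same signature if and only if $m$ and $n$ satisfy all three of the following conditions: (a$'$) $m \ge 3$ and $n \ge 3$; (b$'$) $d \ge 2$; (c$'$) if $d = 2$, then furthermore either $m \equiv 0 \pmod 4$ or $n \equiv 0 \pmod 4$.
   Context: The $m \times n$ grid is the plane graph whose vertices are the integer points $(x, y)$ with $1 \le x \le m$ and $1 \le y \le n$ and whose edges are the unit segments between these points; its finite faces are the unit square cells. The signature of a cycle $C$ on the grid is the function assigning to each cell the number of edges of that cell which belong to $C$. *)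

theory Defs
  imports Main "HOL-Library.FuncSet" "HOL-Number_Theory.Cong"
begin

text \<open>
  Undirected simple graphs are given by their set of edges, an edge being the set of its two
  endpoints. A cycle is identified with its set of edges, so that cyclic vertex sequences
  which differ only in starting point or direction give the same cycle.
\<close>

definition closed_walk_edges :: "'a list \<Rightarrow> 'a set set" where
  "closed_walk_edges vs = {{vs ! i, vs ! (Suc i mod length vs)} | i. i < length vs}"

definition is_cycle :: "'a set set \<Rightarrow> 'a set set \<Rightarrow> bool" where
  "is_cycle E C \<longleftrightarrow>
     (\<exists>vs. length vs \<ge> 3 \<and> distinct vs \<and> closed_walk_edges vs \<subseteq> E \<and> C = closed_walk_edges vs)"

definition grid_vertices :: "nat \<Rightarrow> nat \<Rightarrow> (nat \<times> nat) set" where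
  "grid_vertices m n = {1..m} \<times> {1..n}"

definition unit_segments :: "(nat \<times> nat) set set" where
  "unit_segments = {{(x, y), (x + 1, y)} | x y. True} \<union> {{(x, y), (x, y + 1)} | x y. True}"

definition grid_edges :: "nat \<Rightarrow> nat \<Rightarrow> (nat \<times> nat) set set" where
  "grid_edges m n = {e \<in> unit_segments. e \<subseteq> grid_vertices m n}"

text \<open>A unit square cell is represented by its lower left corner.\<close>

definition grid_cells :: "nat \<Rightarrow> nat \<Rightarrow> (nat \<times> nat) set" where
  "grid_cells m n = {1..<m} \<times> {1..<n}"

fun cell_edges :: "nat \<times> nat \<Rightarrow> (nat \<times> nat) set set" where
  "cell_edges (x, y) =
     {{(x, y), (x + 1, y)}, {(x, y + 1), (x + 1, y + 1)},
      {(x, y), (x, y + 1)}, {(x + 1, y), (x + 1, y + 1)}}"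

text \<open>
  The signature is a function on the cells of the grid only; \<open>restrict\<close> makes equality of
  signatures mean agreement on all of these cells.
\<close>

definition signature :: "nat \<Rightarrow> nat \<Rightarrow> (nat \<times> nat) set set \<Rightarrow> nat \<times> nat \<Rightarrow> nat" where
  "signature m n C = (\<lambda>c\<in>grid_cells m n. card (cell_edges c \<inter> C))"

end

theory Submission
  imports Defs "HOL-Combinatorics.Combinatorics"
begin

text \<open>
  Uniqueness. Let \<open>D\<close> be the symmetric difference of two cycles with the same signature. It meets
  every vertex and every cell in an even number of edges, so on the lattice of edge midpoints it
  satisfies the wave equation modulo 2, with value zero on the walls of the box that surrounds the
  grid. Unfolding the reflections at the walls expresses \<open>D\<close> through an even function on the
  even integers that has the periods \<open>4 * m\<close> and \<open>4 * n\<close>, hence \<open>4 * d\<close>. For \<open>d = 1\<close> this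
  forces \<open>D\<close> to be empty. For \<open>d = 2\<close> the only other possibility is that \<open>D\<close> consists of the
  boundaries of all cells with odd coordinates, the blocks. Each block then has two edges in
  either cycle: adjacent ones in \<open>L\<close> blocks and opposite ones in \<open>N\<close> blocks. The cycle has length
  \<open>4 * N + 3 * L\<close>, which is even, so \<open>L\<close> is even. Orient both cycles with the interior on the
  left; the quotient of the two successor permutations is a product of \<open>N\<close> transpositions and
  \<open>L\<close> 3-cycles. Both permutations are single cycles of even length, so \<open>N\<close> is even as well. But
  \<open>N + L = (m div 2) * (n div 2)\<close> is odd when \<open>m\<close> and \<open>n\<close> are both 2 modulo 4.

  Existence. Reflected copies of an ambiguous pair, with the roles of the two cycles interchanged
  in every other copy, can be joined across edges common to both cycles. So it is enough to have
  such pairs on the squares of odd side and on the grids of size 4 by an even number.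
\<close>

section \<open>Paths and cycles\<close>

fun path_edges :: "'a list \<Rightarrow> 'a set set" where
  "path_edges (x # y # zs) = insert {x, y} (path_edges (y # zs))"
| "path_edges _ = {}"

lemma path_edges_conv_nth: "path_edges xs = {{xs ! i, xs ! Suc i} |i. Suc i < length xs}"
proof (induction xs rule: path_edges.induct)
  case (1 x y zs)
  have "{{(x # y # zs) ! i, (x # y # zs) ! Suc i} |i. Suc i < length (x # y # zs)} =
     insert {x, y} {{(y # zs) ! i, (y # zs) ! Suc i} |i. Suc i < length (y # zs)}" (is "?l = ?r")
  proof
    show "?l \<subseteq> ?r"
    proof
      fix e assume "e \<in> ?l"
      then obtain i where "e = {(x # y # zs) ! i, (x # y # zs) ! Suc i}" "Suc i < length (x # y # zs)"
        by blast
      then show "e \<in> ?r" by (cases i) auto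
    qed
    show "?r \<subseteq> ?l" by (force intro: exI[of _ 0] exI[of _ "Suc _"])
  qed
  then show ?case using 1 by simp
qed auto

lemma path_edges_append:
  "path_edges (xs @ y # ys) = path_edges (xs @ [y]) \<union> path_edges (y # ys)"
proof (induction xs)
  case (Cons a xs)
  then show ?case by (cases xs) auto
qed auto

lemma path_edges_rev: "path_edges (rev xs) = path_edges xs"
proof (induction xs rule: path_edges.induct)
  case (1 x y zs)
  have "path_edges (rev (x # y # zs)) = path_edges (rev (y # zs)) \<union> path_edges [y, x]"
    using path_edges_append[of "rev zs" y "[x]"] by simp
  then show ?case using 1 by (simp add: insert_commute)
qed auto

lemma path_edges_subset: "e \<in> path_edges xs \<Longrightarrow> e \<subseteq> set xs"
  by (induction xs rule: path_edges.induct) auto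

lemma path_edges_map: "path_edges (map f xs) = (`) f ` path_edges xs"
  by (induction xs rule: path_edges.induct) auto

lemma closed_walk_edges_Cons: "closed_walk_edges (x # xs) = path_edges (x # xs @ [x])"
proof -
  have "(x # xs) ! i = (x # xs @ [x]) ! i" if "i < length (x # xs)" for i
    using that by (auto simp: nth_Cons nth_append split: nat.splits)
  moreover have "(x # xs) ! (Suc i mod length (x # xs)) = (x # xs @ [x]) ! Suc i"
    if "i < length (x # xs)" for i
  proof (cases "Suc i = length (x # xs)")
    case True then show ?thesis by (simp add: nth_append)
  next
    case False then show ?thesis using that by (auto simp: nth_append)
  qed
  ultimately have "closed_walk_edges (x # xs) =
     (\<lambda>i. {(x # xs @ [x]) ! i, (x # xs @ [x]) ! Suc i}) ` {i. i < length (x # xs)}"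
    unfolding closed_walk_edges_def setcompr_eq_image by (intro image_cong) simp_all
  then show ?thesis by (simp add: path_edges_conv_nth setcompr_eq_image)
qed

lemma closed_walk_edges_ends:
  "closed_walk_edges (a # xs @ [b]) = insert {a, b} (path_edges (a # xs @ [b]))"
proof -
  have "path_edges ((a # xs) @ b # [a]) = path_edges ((a # xs) @ [b]) \<union> path_edges [b, a]"
    by (rule path_edges_append)
  moreover have "path_edges [b, a] = {{a, b}}" by (simp add: insert_commute)
  ultimately show ?thesis unfolding closed_walk_edges_Cons by simp
qed

lemma closed_walk_edges_rotate1: "closed_walk_edges (rotate1 vs) = closed_walk_edges vs"
proof (cases vs)
  case (Cons x xs)
  show ?thesis
  proof (cases xs)
    case (Cons y ys)
    then show ?thesis using \<open>vs = x # xs\<close> path_edges_append[of "y # ys" x "[y]"]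
      by (auto simp: closed_walk_edges_Cons)
  qed (use Cons in auto)
qed auto

lemma closed_walk_edges_rotate: "closed_walk_edges (rotate k vs) = closed_walk_edges vs"
  by (induction k) (auto simp: closed_walk_edges_rotate1)

lemma closed_walk_edges_rev: "closed_walk_edges (rev vs) = closed_walk_edges vs"
proof (cases vs)
  case (Cons x xs)
  have "closed_walk_edges (rev vs) = closed_walk_edges (rotate1 (x # rev xs))"
    using Cons by simp
  also have "\<dots> = path_edges (rev (x # xs @ [x]))"
    by (simp only: closed_walk_edges_rotate1 closed_walk_edges_Cons) simp
  finally show ?thesis using Cons by (simp only: path_edges_rev closed_walk_edges_Cons)
qed auto

lemma closed_walk_edges_map: "closed_walk_edges (map f vs) = (`) f ` closed_walk_edges vs"
proof (cases vs)
  case (Cons x xs)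
  then show ?thesis using path_edges_map[of f "x # xs @ [x]"] by (simp add: closed_walk_edges_Cons)
qed (auto simp: closed_walk_edges_def)

lemma Union_closed_walk_edges: "\<Union> (closed_walk_edges vs) = set vs"
proof
  show "\<Union> (closed_walk_edges vs) \<subseteq> set vs"
  proof (cases vs)
    case (Cons x xs)
    then show ?thesis using path_edges_subset[of _ "x # xs @ [x]"]
      by (auto simp: closed_walk_edges_Cons)
  qed (auto simp: closed_walk_edges_def)
  show "set vs \<subseteq> \<Union> (closed_walk_edges vs)"
  proof
    fix v assume "v \<in> set vs"
    then obtain i where "i < length vs" "v = vs ! i" by (auto simp: in_set_conv_nth)
    then have "{v, vs ! (Suc i mod length vs)} \<in> closed_walk_edges vs"
      unfolding closed_walk_edges_def by blast
    then show "v \<in> \<Union> (closed_walk_edges vs)" by blast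
  qed
qed

lemma is_cycle_image:
  assumes "is_cycle E C" "inj_on f (\<Union> C)"
  shows "is_cycle ((`) f ` E) ((`) f ` C)"
proof -
  obtain vs where vs: "length vs \<ge> 3" "distinct vs" "closed_walk_edges vs \<subseteq> E" "C = closed_walk_edges vs"
    using assms(1) unfolding is_cycle_def by blast
  have "distinct (map f vs)"
    using vs assms(2) by (simp add: distinct_map Union_closed_walk_edges)
  then show ?thesis unfolding is_cycle_def
    using vs by (intro exI[of _ "map f vs"]) (auto simp: closed_walk_edges_map)
qed

lemma is_cycle_mono: "is_cycle E C \<Longrightarrow> C \<subseteq> E' \<Longrightarrow> is_cycle E' C"
  unfolding is_cycle_def by blast

lemma is_cycle_subset: "is_cycle E C \<Longrightarrow> C \<subseteq> E"
  unfolding is_cycle_def by blast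

text \<open>Removing an edge leaves a path through all vertices of the cycle. Joining two cycles and
  counting the neighbours of a vertex both start from this form.\<close>

lemma is_cycle_cut_edge:
  assumes "is_cycle E C" "{a, b} \<in> C"
  obtains xs where "distinct (a # xs @ [b])" "C = insert {a, b} (path_edges (a # xs @ [b]))"
    "{a, b} \<notin> path_edges (a # xs @ [b])" "xs \<noteq> []"
proof -
  obtain vs where vs: "length vs \<ge> 3" "distinct vs" "closed_walk_edges vs \<subseteq> E" "C = closed_walk_edges vs"
    using assms(1) unfolding is_cycle_def by blast
  obtain i where i: "i < length vs" "{a, b} = {vs ! i, vs ! (Suc i mod length vs)}"
    using assms(2) vs unfolding closed_walk_edges_def by blast
  \<comment> \<open>This rotation makes the chosen edge the closing one, from the last entry back to
    the first; the reversal in \<open>ws\<close> below then puts \<open>a\<close> first.\<close>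
  define us where "us = rotate (Suc i) vs"
  have us: "length us \<ge> 3" "distinct us" "C = closed_walk_edges us"
    using vs by (simp_all add: us_def closed_walk_edges_rotate del: rotate_Suc)
  have ne: "us \<noteq> []" using us by auto
  have h: "hd us = vs ! (Suc i mod length vs)"
    unfolding us_def using vs by (subst hd_rotate_conv_nth) auto
  have "last us = vs ! ((Suc i + (length vs - 1)) mod length vs)"
    using ne vs by (simp add: last_conv_nth us_def nth_rotate del: rotate_Suc)
  also have "Suc i + (length vs - 1) = i + length vs" using i by simp
  also have "(i + length vs) mod length vs = i" using i by simp
  finally have l: "last us = vs ! i" .
  have ends: "{a, b} = {hd us, last us}" using i h l by auto
  define ws where "ws = (if hd us = a then us else rev us)"
  have hl: "hd us \<noteq> last us" using us by (cases us) (auto split: if_splits)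
  have ws: "length ws \<ge> 3" "distinct ws" "C = closed_walk_edges ws" "hd ws = a" "last ws = b"
    using us ends hl ne unfolding ws_def
    by (auto simp: closed_walk_edges_rev hd_rev last_rev doubleton_eq_iff)
  obtain ys where ys: "ws = a # ys" using ws by (cases ws) auto
  obtain xs where xs: "ys = xs @ [b]" using ys ws by (cases ys rule: rev_cases) auto
  have "xs \<noteq> []" using ws ys xs by auto
  then obtain z zs where z: "xs = z # zs" by (cases xs) auto
  have C: "C = insert {a, b} (path_edges (a # xs @ [b]))"
    unfolding closed_walk_edges_ends[symmetric] using ws ys xs by simp
  have "a \<notin> e" if "e \<in> path_edges (z # zs @ [b])" for e
    using path_edges_subset[OF that] ws ys xs z by auto
  moreover have "{a, b} \<noteq> {a, z}" using ws ys xs z by (auto simp: doubleton_eq_iff)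
  ultimately have "{a, b} \<notin> path_edges (a # xs @ [b])" using z by auto
  then show ?thesis using that C ws ys xs \<open>xs \<noteq> []\<close> by auto
qed

text \<open>Cut both cycles open and cross over: along the first path from \<open>a\<close> to
  \<open>b\<close>, across to \<open>d\<close>, back along the second path to \<open>c\<close>, and
  across to \<open>a\<close>.\<close>

lemma is_cycle_join:
  assumes C: "is_cycle E C" "{a, b} \<in> C" and D: "is_cycle F D" "{c, d} \<in> D"
    and disj: "\<Union> C \<inter> \<Union> D = {}"
  shows "is_cycle (E \<union> F \<union> {{a, c}, {b, d}})
           (C - {{a, b}} \<union> (D - {{c, d}}) \<union> {{a, c}, {b, d}})"
proof -
  obtain xs where xs: "distinct (a # xs @ [b])" "C = insert {a, b} (path_edges (a # xs @ [b]))"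
    "{a, b} \<notin> path_edges (a # xs @ [b])"
    using is_cycle_cut_edge[OF C] by metis
  obtain ys where ys: "distinct (c # ys @ [d])" "D = insert {c, d} (path_edges (c # ys @ [d]))"
    "{c, d} \<notin> path_edges (c # ys @ [d])"
    using is_cycle_cut_edge[OF D] by metis
  let ?p = "a # xs @ [b]" and ?q = "c # ys @ [d]"
  have "set ?p \<subseteq> \<Union> C" "set ?q \<subseteq> \<Union> D"
    unfolding xs(2) ys(2) closed_walk_edges_ends[symmetric] Union_closed_walk_edges by simp_all
  then have dis: "distinct (?p @ rev ?q)"
    unfolding distinct_append distinct_rev set_rev using xs(1) ys(1) disj by blast
  have "closed_walk_edges (?p @ rev ?q) = path_edges ((a # xs) @ b # d # rev ys @ [c, a])"
    by (simp add: closed_walk_edges_Cons)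
  also have "\<dots> = path_edges ?p \<union> path_edges (b # d # rev ys @ [c, a])"
    by (subst path_edges_append) simp
  also have "\<dots> = path_edges ?p \<union> (insert {b, d} (path_edges ((d # rev ys) @ c # [a])))" by simp
  also have "\<dots> = path_edges ?p \<union> (insert {b, d} (path_edges (rev ?q) \<union> path_edges [c, a]))"
    by (subst path_edges_append) simp
  also have "\<dots> = C - {{a, b}} \<union> (D - {{c, d}}) \<union> {{a, c}, {b, d}}"
  proof -
    have "C - {{a, b}} = path_edges ?p" "D - {{c, d}} = path_edges ?q"
      unfolding xs(2) ys(2) using xs(3) ys(3) by blast+
    moreover have "path_edges [c, a] = {{a, c}}" by (simp add: insert_commute)
    ultimately show ?thesis unfolding path_edges_rev by auto
  qed
  finally have e: "closed_walk_edges (?p @ rev ?q) = \<dots>" .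
  have "C \<subseteq> E" "D \<subseteq> F" using C D by (auto dest: is_cycle_subset)
  then show ?thesis
    unfolding is_cycle_def e[symmetric]
    by (intro exI[of _ "?p @ rev ?q"]) (use dis in \<open>auto simp: e simp del: rev.simps append.simps\<close>)
qed

section \<open>Edges of the grid\<close>

definition hedge :: "nat \<Rightarrow> nat \<Rightarrow> (nat \<times> nat) set" where
  "hedge x y = {(x, y), (x + 1, y)}"

definition vedge :: "nat \<Rightarrow> nat \<Rightarrow> (nat \<times> nat) set" where
  "vedge x y = {(x, y), (x, y + 1)}"

lemma hedge_eq_iff [simp]: "hedge x y = hedge x' y' \<longleftrightarrow> x = x' \<and> y = y'"
  by (auto simp: hedge_def doubleton_eq_iff)

lemma vedge_eq_iff [simp]: "vedge x y = vedge x' y' \<longleftrightarrow> x = x' \<and> y = y'"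
  by (auto simp: vedge_def doubleton_eq_iff)

lemma hedge_neq_vedge [simp]: "hedge x y \<noteq> vedge x' y'" "vedge x' y' \<noteq> hedge x y"
  by (auto simp: hedge_def vedge_def doubleton_eq_iff)

lemma hedge_in_grid_edges [simp]:
  "hedge x y \<in> grid_edges m n \<longleftrightarrow> 1 \<le> x \<and> x < m \<and> 1 \<le> y \<and> y \<le> n"
  unfolding grid_edges_def unit_segments_def grid_vertices_def hedge_def by auto

lemma vedge_in_grid_edges [simp]:
  "vedge x y \<in> grid_edges m n \<longleftrightarrow> 1 \<le> x \<and> x \<le> m \<and> 1 \<le> y \<and> y < n"
  unfolding grid_edges_def unit_segments_def grid_vertices_def vedge_def by auto

lemma grid_edges_cases:
  assumes "e \<in> grid_edges m n"
  obtains x y where "e = hedge x y" | x y where "e = vedge x y"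
  using assms unfolding grid_edges_def unit_segments_def hedge_def vedge_def by blast

lemma grid_edge_set_eqI:
  assumes "C \<subseteq> grid_edges m n" "D \<subseteq> grid_edges m' n'"
    and "\<And>x y. hedge x y \<in> C \<longleftrightarrow> hedge x y \<in> D" "\<And>x y. vedge x y \<in> C \<longleftrightarrow> vedge x y \<in> D"
  shows "C = D"
proof
  show "C \<subseteq> D"
  proof
    fix e assume e: "e \<in> C"
    with assms(1) have "e \<in> grid_edges m n" by blast
    then show "e \<in> D" using e assms(3,4) by (cases rule: grid_edges_cases) simp_all
  qed
  show "D \<subseteq> C"
  proof
    fix e assume e: "e \<in> D"
    with assms(2) have "e \<in> grid_edges m' n'" by blast
    then show "e \<in> C" using e assms(3,4) by (cases rule: grid_edges_cases) simp_all
  qed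
qed

definition cell_count :: "(nat \<times> nat) set set \<Rightarrow> nat \<Rightarrow> nat \<Rightarrow> nat" where
  "cell_count C x y = of_bool (hedge x y \<in> C) + of_bool (hedge x (y + 1) \<in> C)
     + of_bool (vedge x y \<in> C) + of_bool (vedge (x + 1) y \<in> C)"

lemma card_insert_Int:
  assumes "finite A" "a \<notin> A"
  shows "card (insert a A \<inter> C) = of_bool (a \<in> C) + card (A \<inter> C)"
  using assms by (cases "a \<in> C") (auto simp: Int_insert_left)

lemma card_cell_edges: "card (cell_edges (x, y) \<inter> C) = cell_count C x y"
proof -
  have "cell_edges (x, y) = {hedge x y, hedge x (y + 1), vedge x y, vedge (x + 1) y}"
    by (simp add: hedge_def vedge_def)
  then show ?thesis by (simp add: card_insert_Int cell_count_def)
qed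

lemma signature_eq_iff:
  "signature m n C = signature m n D \<longleftrightarrow>
     (\<forall>x\<in>{1..<m}. \<forall>y\<in>{1..<n}. cell_count C x y = cell_count D x y)"
  unfolding signature_def restrict_def grid_cells_def
  by (auto simp: fun_eq_iff card_cell_edges simp del: cell_edges.simps split: if_splits)

definition ambiguous_pair :: "nat \<Rightarrow> nat \<Rightarrow> (nat \<times> nat) set set \<Rightarrow> (nat \<times> nat) set set \<Rightarrow> bool" where
  "ambiguous_pair m n C C' \<longleftrightarrow> is_cycle (grid_edges m n) C \<and> is_cycle (grid_edges m n) C' \<and>
     C \<noteq> C' \<and> signature m n C = signature m n C'"

lemma ambiguous_pair_subset:
  assumes "ambiguous_pair m n C C'" shows "C \<subseteq> grid_edges m n" "C' \<subseteq> grid_edges m n"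
  using assms unfolding ambiguous_pair_def by (auto dest: is_cycle_subset)

lemma ambiguous_pair_sym: "ambiguous_pair m n C C' \<Longrightarrow> ambiguous_pair m n C' C"
  unfolding ambiguous_pair_def by auto

lemma grid_edges_image_iff:
  assumes "C \<subseteq> grid_edges m n"
  shows "e \<in> (`) f ` C \<longleftrightarrow>
    (\<exists>x y. hedge x y \<in> C \<and> e = {f (x, y), f (x + 1, y)}) \<or>
    (\<exists>x y. vedge x y \<in> C \<and> e = {f (x, y), f (x, y + 1)})"
proof
  assume "e \<in> (`) f ` C"
  then obtain d where d: "d \<in> C" "e = f ` d" by blast
  with assms have "d \<in> grid_edges m n" by blast
  then show "(\<exists>x y. hedge x y \<in> C \<and> e = {f (x, y), f (x + 1, y)}) \<or>
    (\<exists>x y. vedge x y \<in> C \<and> e = {f (x, y), f (x, y + 1)})"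
    using d by (cases rule: grid_edges_cases) (auto simp: hedge_def vedge_def)
next
  have "f ` hedge x y = {f (x, y), f (x + 1, y)}" "f ` vedge x y = {f (x, y), f (x, y + 1)}" for x y
    by (auto simp: hedge_def vedge_def)
  moreover assume "(\<exists>x y. hedge x y \<in> C \<and> e = {f (x, y), f (x + 1, y)}) \<or>
    (\<exists>x y. vedge x y \<in> C \<and> e = {f (x, y), f (x, y + 1)})"
  ultimately show "e \<in> (`) f ` C" by (metis image_eqI)
qed

lemma hedge_bounds:
  assumes "C \<subseteq> grid_edges m n" "hedge x y \<in> C"
  shows "1 \<le> x" "x < m" "1 \<le> y" "y \<le> n"
  using subsetD[OF assms] by simp_all

lemma vedge_bounds:
  assumes "C \<subseteq> grid_edges m n" "vedge x y \<in> C"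
  shows "1 \<le> x" "x \<le> m" "1 \<le> y" "y < n"
  using subsetD[OF assms] by simp_all

lemma Union_grid_edges: "C \<subseteq> grid_edges m n \<Longrightarrow> \<Union> C \<subseteq> grid_vertices m n"
  unfolding grid_edges_def by blast

lemma is_cycle_grid_image:
  assumes "is_cycle (grid_edges m n) C" "inj_on f (grid_vertices m n)"
    and "\<And>x y. hedge x y \<in> grid_edges m n \<Longrightarrow> {f (x, y), f (x + 1, y)} \<in> grid_edges m' n'"
    and "\<And>x y. vedge x y \<in> grid_edges m n \<Longrightarrow> {f (x, y), f (x, y + 1)} \<in> grid_edges m' n'"
  shows "is_cycle (grid_edges m' n') ((`) f ` C)"
proof -
  have C: "C \<subseteq> grid_edges m n" using assms(1) by (rule is_cycle_subset)
  have "is_cycle ((`) f ` grid_edges m n) ((`) f ` C)"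
    using assms(1) inj_on_subset[OF assms(2) Union_grid_edges[OF C]] by (rule is_cycle_image)
  moreover have "(`) f ` C \<subseteq> grid_edges m' n'"
    using C assms(3,4) unfolding subset_iff grid_edges_image_iff[OF C] by blast
  ultimately show ?thesis by (rule is_cycle_mono)
qed

section \<open>Translation, reflection and transposition of grid cycles\<close>

definition shift :: "nat \<Rightarrow> nat \<times> nat \<Rightarrow> nat \<times> nat" where
  "shift k = (\<lambda>(x, y). (x + k, y))"

definition mirror :: "nat \<Rightarrow> nat \<times> nat \<Rightarrow> nat \<times> nat" where
  "mirror m = (\<lambda>(x, y). (m + 1 - x, y))"

lemma shift_edge [simp]:
  "{shift k (x, y), shift k (Suc x, y)} = hedge (x + k) y"
  "{shift k (x, y), shift k (x, Suc y)} = vedge (x + k) y"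
  by (auto simp: shift_def hedge_def vedge_def)

lemma mirror_edge:
  "x < m \<Longrightarrow> {mirror m (x, y), mirror m (Suc x, y)} = hedge (m - x) y"
  "{mirror m (x, y), mirror m (x, Suc y)} = vedge (m + 1 - x) y"
  by (auto simp: mirror_def hedge_def vedge_def)

lemma swap_edge [simp]:
  "{prod.swap (x, y), prod.swap (Suc x, y)} = vedge y x"
  "{prod.swap (x, y), prod.swap (x, Suc y)} = hedge y x"
  by (auto simp: hedge_def vedge_def)

lemma
  assumes "C \<subseteq> grid_edges m n"
  shows hedge_shift: "hedge x y \<in> (`) (shift k) ` C \<longleftrightarrow> k \<le> x \<and> hedge (x - k) y \<in> C"
    and vedge_shift: "vedge x y \<in> (`) (shift k) ` C \<longleftrightarrow> k \<le> x \<and> vedge (x - k) y \<in> C"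
  unfolding grid_edges_image_iff[OF assms] by (auto intro: exI[of _ "x - k"])

lemma
  assumes "C \<subseteq> grid_edges m n"
  shows hedge_swap: "hedge x y \<in> (`) prod.swap ` C \<longleftrightarrow> vedge y x \<in> C"
    and vedge_swap: "vedge x y \<in> (`) prod.swap ` C \<longleftrightarrow> hedge y x \<in> C"
  unfolding grid_edges_image_iff[OF assms] by (auto simp del: prod.swap_def swap_simp)

lemma hedge_mirror:
  assumes "C \<subseteq> grid_edges m n"
  shows "hedge x y \<in> (`) (mirror m) ` C \<longleftrightarrow> x < m \<and> hedge (m - x) y \<in> C"
proof
  assume "hedge x y \<in> (`) (mirror m) ` C"
  then obtain a b where "hedge a b \<in> C" "hedge x y = {mirror m (a, b), mirror m (Suc a, b)}"
    unfolding grid_edges_image_iff[OF assms] by (auto simp: mirror_edge(2))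
  then show "x < m \<and> hedge (m - x) y \<in> C"
    using hedge_bounds[OF assms, of a b] by (auto simp: mirror_edge(1))
next
  assume a: "x < m \<and> hedge (m - x) y \<in> C"
  then have "hedge x y = {mirror m (m - x, y), mirror m (m - x + 1, y)}"
    using hedge_bounds[OF assms, of "m - x" y] by (simp add: mirror_edge(1))
  then show "hedge x y \<in> (`) (mirror m) ` C"
    using a unfolding grid_edges_image_iff[OF assms] by blast
qed

lemma vedge_mirror:
  assumes "C \<subseteq> grid_edges m n"
  shows "vedge x y \<in> (`) (mirror m) ` C \<longleftrightarrow> x \<le> m \<and> vedge (m + 1 - x) y \<in> C"
proof
  assume "vedge x y \<in> (`) (mirror m) ` C"
  then obtain a b where "vedge a b \<in> C" "vedge x y = {mirror m (a, b), mirror m (a, Suc b)}"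
    unfolding grid_edges_image_iff[OF assms]
    using hedge_bounds[OF assms] by (fastforce simp: mirror_edge)
  then show "x \<le> m \<and> vedge (m + 1 - x) y \<in> C"
    using vedge_bounds[OF assms, of a b] by (auto simp: mirror_edge(2))
next
  assume a: "x \<le> m \<and> vedge (m + 1 - x) y \<in> C"
  then have "vedge x y = {mirror m (m + 1 - x, y), mirror m (m + 1 - x, y + 1)}"
    using vedge_bounds[OF assms, of "m + 1 - x" y] by (simp add: mirror_edge(2))
  then show "vedge x y \<in> (`) (mirror m) ` C"
    using a unfolding grid_edges_image_iff[OF assms] by blast
qed

lemma inj_on_mirror: "inj_on (mirror m) (grid_vertices m n)"
  by (auto simp: inj_on_def mirror_def grid_vertices_def)

lemma inj_on_shift: "inj_on (shift k) A"
  by (auto simp: inj_on_def shift_def)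

lemma is_cycle_swap:
  "is_cycle (grid_edges m n) C \<Longrightarrow> is_cycle (grid_edges n m) ((`) prod.swap ` C)"
  by (erule is_cycle_grid_image[OF _ inj_swap]) (auto simp del: swap_simp)

lemma is_cycle_mirror:
  "is_cycle (grid_edges m n) C \<Longrightarrow> is_cycle (grid_edges m n) ((`) (mirror m) ` C)"
  by (erule is_cycle_grid_image[OF _ inj_on_mirror]) (auto simp: mirror_edge)

lemma is_cycle_shift:
  "is_cycle (grid_edges m n) C \<Longrightarrow> is_cycle (grid_edges (k + m) n) ((`) (shift k) ` C)"
  by (erule is_cycle_grid_image[OF _ inj_on_shift]) auto

lemma grid_image_eq_iff:
  assumes "inj_on f (grid_vertices m n)" "C \<subseteq> grid_edges m n" "C' \<subseteq> grid_edges m n"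
  shows "(`) f ` C = (`) f ` C' \<longleftrightarrow> C = C'"
proof (rule inj_on_image_eq_iff)
  show "inj_on ((`) f) (Pow (grid_vertices m n))" using assms(1) by (rule inj_on_image_Pow)
  have "grid_edges m n \<subseteq> Pow (grid_vertices m n)" unfolding grid_edges_def by blast
  then show "C \<subseteq> Pow (grid_vertices m n)" "C' \<subseteq> Pow (grid_vertices m n)" using assms by blast+
qed

lemma ambiguous_pair_swap:
  assumes "ambiguous_pair m n C C'"
  shows "ambiguous_pair n m ((`) prod.swap ` C) ((`) prod.swap ` C')"
proof -
  note sub = ambiguous_pair_subset[OF assms]
  have "cell_count ((`) prod.swap ` D) x y = cell_count D y x" if "D \<subseteq> grid_edges m n" for D x y
    by (simp add: cell_count_def hedge_swap[OF that] vedge_swap[OF that])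
  note cc = this[OF sub(1)] this[OF sub(2)]
  have "signature n m ((`) prod.swap ` C) = signature n m ((`) prod.swap ` C')"
    using assms unfolding ambiguous_pair_def signature_eq_iff cc by blast
  moreover have "(`) prod.swap ` C \<noteq> (`) prod.swap ` C'"
    using assms grid_image_eq_iff[OF inj_swap sub]
    unfolding ambiguous_pair_def by simp
  ultimately show ?thesis
    using assms is_cycle_swap unfolding ambiguous_pair_def by blast
qed

lemma ambiguous_pair_mirror:
  assumes "ambiguous_pair m n C C'"
  shows "ambiguous_pair m n ((`) (mirror m) ` C) ((`) (mirror m) ` C')"
proof -
  note sub = ambiguous_pair_subset[OF assms]
  have cc: "cell_count ((`) (mirror m) ` D) x y = cell_count D (m - x) y"
    if "D \<subseteq> grid_edges m n" "x < m" for D x y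
    using that(2) by (simp add: cell_count_def hedge_mirror[OF that(1)] vedge_mirror[OF that(1)] Suc_diff_le)
  have "cell_count ((`) (mirror m) ` C) x y = cell_count ((`) (mirror m) ` C') x y"
    if "x \<in> {1..<m}" "y \<in> {1..<n}" for x y
  proof -
    have "m - x \<in> {1..<m}" using that by auto
    then have "cell_count C (m - x) y = cell_count C' (m - x) y"
      using assms that unfolding ambiguous_pair_def signature_eq_iff by blast
    then show ?thesis using that cc[OF sub(1), of x y] cc[OF sub(2), of x y] by simp
  qed
  then have "signature m n ((`) (mirror m) ` C) = signature m n ((`) (mirror m) ` C')"
    unfolding signature_eq_iff by blast
  moreover have "(`) (mirror m) ` C \<noteq> (`) (mirror m) ` C'"
    using assms grid_image_eq_iff[OF inj_on_mirror sub] unfolding ambiguous_pair_def by simp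
  ultimately show ?thesis
    using assms is_cycle_mirror unfolding ambiguous_pair_def by blast
qed

section \<open>Joining pairs of cycles\<close>

definition joined ::
  "nat \<Rightarrow> nat \<Rightarrow> (nat \<times> nat) set set \<Rightarrow> (nat \<times> nat) set set \<Rightarrow> (nat \<times> nat) set set" where
  "joined m y C D =
     C - {vedge m y} \<union> ((`) (shift m) ` D - {vedge (m + 1) y}) \<union> {hedge m y, hedge m (y + 1)}"

lemma hedge_joined:
  assumes "C \<subseteq> grid_edges m n" "D \<subseteq> grid_edges m' n"
  shows "hedge x y \<in> joined m y0 C D \<longleftrightarrow>
    (if x < m then hedge x y \<in> C else if x = m then y = y0 \<or> y = y0 + 1 else hedge (x - m) y \<in> D)"
  using hedge_bounds[OF assms(1), of x y] hedge_bounds[OF assms(2), of "x - m" y]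
  by (auto simp: joined_def hedge_shift[OF assms(2)])

lemma vedge_joined:
  assumes "C \<subseteq> grid_edges m n" "D \<subseteq> grid_edges m' n"
  shows "vedge x y \<in> joined m y0 C D \<longleftrightarrow>
    (if x \<le> m then vedge x y \<in> C \<and> (x, y) \<noteq> (m, y0)
     else vedge (x - m) y \<in> D \<and> (x, y) \<noteq> (m + 1, y0))"
  using vedge_bounds[OF assms(1), of x y] vedge_bounds[OF assms(2), of "x - m" y]
  by (auto simp: joined_def vedge_shift[OF assms(2)])

lemma is_cycle_joined:
  assumes C: "is_cycle (grid_edges m n) C" "vedge m y \<in> C"
    and D: "is_cycle (grid_edges m' n) D" "vedge 1 y \<in> D"
  shows "is_cycle (grid_edges (m + m') n) (joined m y C D)"
proof -
  note sub = C(1)[THEN is_cycle_subset] D(1)[THEN is_cycle_subset]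
  have b: "1 \<le> m" "1 \<le> y" "y < n" "1 \<le> m'"
    using vedge_bounds[OF sub(1) C(2)] vedge_bounds[OF sub(2) D(2)] by auto
  have D': "is_cycle (grid_edges (m + m') n) ((`) (shift m) ` D)"
    using D(1) by (rule is_cycle_shift)
  have vD: "vedge (m + 1) y \<in> (`) (shift m) ` D"
    using D(2) by (simp add: vedge_shift[OF sub(2)])
  have "\<Union> C \<subseteq> {..m} \<times> UNIV"
    using Union_grid_edges[OF sub(1)] unfolding grid_vertices_def by auto
  moreover have "\<Union> ((`) (shift m) ` D) \<subseteq> {m<..} \<times> UNIV"
    using Union_grid_edges[OF sub(2)] unfolding grid_vertices_def shift_def by auto
  ultimately have "\<Union> C \<inter> \<Union> ((`) (shift m) ` D) = {}" by fastforce
  then have "is_cycle (grid_edges m n \<union> grid_edges (m + m') n \<union> {hedge m y, hedge m (y + 1)})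
      (joined m y C D)"
    using is_cycle_join[OF C(1) _ D' _, of "(m, y)" "(m, y + 1)" "(m + 1, y)" "(m + 1, y + 1)"] C(2) vD
    by (simp add: joined_def hedge_def vedge_def)
  moreover have "joined m y C D \<subseteq> grid_edges (m + m') n"
  proof -
    have "grid_edges m n \<subseteq> grid_edges (m + m') n"
      by (auto simp: grid_edges_def grid_vertices_def)
    moreover have "hedge m y \<in> grid_edges (m + m') n" "hedge m (y + 1) \<in> grid_edges (m + m') n"
      using b by simp_all
    ultimately show ?thesis using sub(1) is_cycle_subset[OF D'] unfolding joined_def by blast
  qed
  ultimately show ?thesis by (rule is_cycle_mono)
qed

text \<open>Both joined cycles undergo the same removals and additions, so cells away from the seam
  stay balanced. In the column of cells at the seam, \<open>opp\<close> says that the two vertical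
  sides contribute equally in total.\<close>

lemma ambiguous_pair_joined:
  assumes C: "ambiguous_pair m n C C'" "vedge m y0 \<in> C" "vedge m y0 \<in> C'"
    and D: "ambiguous_pair m' n D D'" "vedge 1 y0 \<in> D" "vedge 1 y0 \<in> D'"
    and opp: "\<And>y. of_bool (vedge m y \<in> C) + of_bool (vedge 1 y \<in> D) =
                (of_bool (vedge m y \<in> C') + of_bool (vedge 1 y \<in> D') :: nat)"
  shows "ambiguous_pair (m + m') n (joined m y0 C D) (joined m y0 C' D')"
proof -
  note sub = ambiguous_pair_subset[OF C(1)] ambiguous_pair_subset[OF D(1)]
  note h = hedge_joined[OF sub(1,3)] hedge_joined[OF sub(2,4)]
  note v = vedge_joined[OF sub(1,3)] vedge_joined[OF sub(2,4)]
  have cyc: "is_cycle (grid_edges (m + m') n) (joined m y0 C D)"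
    "is_cycle (grid_edges (m + m') n) (joined m y0 C' D')"
    using C D is_cycle_joined unfolding ambiguous_pair_def by blast+
  \<comment> \<open>A joined cycle determines its left component, since the only edge removed there
    is known to lie in both \<open>C\<close> and \<open>C'\<close>.\<close>
  have "C = C'" if eq: "joined m y0 C D = joined m y0 C' D'"
  proof (rule grid_edge_set_eqI[OF sub(1,2)])
    fix x y
    show "hedge x y \<in> C \<longleftrightarrow> hedge x y \<in> C'"
      using h[of x y y0] eq hedge_bounds[OF sub(1), of x y] hedge_bounds[OF sub(2), of x y]
      by (cases "x < m") auto
    show "vedge x y \<in> C \<longleftrightarrow> vedge x y \<in> C'"
      using v[of x y y0] eq vedge_bounds[OF sub(1), of x y] vedge_bounds[OF sub(2), of x y] C(2,3)
      by (cases "x \<le> m"; cases "(x, y) = (m, y0)") auto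
  qed
  moreover have "cell_count (joined m y0 C D) x y = cell_count (joined m y0 C' D') x y"
    if xy: "x \<in> {1..<m + m'}" "y \<in> {1..<n}" for x y
  proof -
    consider "x < m" | "x = m" | "m < x" by linarith
    then show ?thesis
    proof cases
      case 1
      then have "cell_count C x y = cell_count C' x y"
        using xy C(1) unfolding ambiguous_pair_def signature_eq_iff by auto
      then show ?thesis using 1 C(2,3)
        by (cases "x + 1 = m \<and> y = y0") (auto simp: cell_count_def h v)
    next
      case 2
      then show ?thesis using opp[of y] C(2,3) D(2,3)
        by (cases "y = y0") (auto simp: cell_count_def h v)
    next
      case 3
      then have "x - m \<in> {1..<m'}" using xy by auto
      then have "cell_count D (x - m) y = cell_count D' (x - m) y"
        using xy D(1) unfolding ambiguous_pair_def signature_eq_iff by auto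
      then show ?thesis using 3 D(2,3)
        by (cases "x = m + 1 \<and> y = y0") (auto simp: cell_count_def h v Suc_diff_le)
    qed
  qed
  ultimately show ?thesis
    using C(1) cyc unfolding ambiguous_pair_def signature_eq_iff by blast
qed

text \<open>
  Reflected copies of a pair, with the roles of its two cycles interchanged in every other copy,
  have complementary facing borders and can therefore be joined in a row.
\<close>

lemma ambiguous_pair_row:
  assumes C: "ambiguous_pair p n C C'" and p2: "2 \<le> p"
    and l: "vedge 1 yl \<in> C \<inter> C'" and r: "vedge p yr \<in> C \<inter> C'"
  shows "\<exists>R R'. ambiguous_pair (Suc k * p) n R R' \<and>
    (\<forall>y. (vedge (Suc k * p) y \<in> R \<longleftrightarrow> (if even k then vedge p y \<in> C else vedge 1 y \<in> C')) \<and>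
         (vedge (Suc k * p) y \<in> R' \<longleftrightarrow> (if even k then vedge p y \<in> C' else vedge 1 y \<in> C))) \<and>
    (\<forall>x y. hedge x y \<in> C \<inter> C' \<longrightarrow> hedge x y \<in> R \<inter> R')"
proof (induction k)
  case 0
  then show ?case using C by (intro exI[of _ C] exI[of _ C']) auto
next
  case (Suc k)
  then obtain R R' where R: "ambiguous_pair (Suc k * p) n R R'"
    "\<And>y. vedge (Suc k * p) y \<in> R \<longleftrightarrow> (if even k then vedge p y \<in> C else vedge 1 y \<in> C')"
    "\<And>y. vedge (Suc k * p) y \<in> R' \<longleftrightarrow> (if even k then vedge p y \<in> C' else vedge 1 y \<in> C)"
    "\<And>x y. hedge x y \<in> C \<inter> C' \<Longrightarrow> hedge x y \<in> R \<inter> R'" by blast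
  note sub = ambiguous_pair_subset[OF C]
  have p: "1 \<le> p" using p2 by simp
  \<comment> \<open>The appended copy shows at the seam the same border as the previous copy, with
    the two cycles interchanged. This is the side \<open>p\<close> of the pattern for even
    \<open>k\<close> and its side 1 for odd \<open>k\<close>, hence the choice between
    \<open>yr\<close> and \<open>yl\<close>.\<close>
  define D where "D = (if even k then (`) (mirror p) ` C' else C)"
  define D' where "D' = (if even k then (`) (mirror p) ` C else C')"
  define y0 where "y0 = (if even k then yr else yl)"
  have D: "ambiguous_pair p n D D'"
    unfolding D_def D'_def using C ambiguous_pair_sym[OF ambiguous_pair_mirror[OF C]] by simp
  note subD = ambiguous_pair_subset[OF D]
  have vl: "vedge 1 y \<in> D \<longleftrightarrow> (if even k then vedge p y \<in> C' else vedge 1 y \<in> C)"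
    "vedge 1 y \<in> D' \<longleftrightarrow> (if even k then vedge p y \<in> C else vedge 1 y \<in> C')" for y
    using p by (simp_all add: D_def D'_def vedge_mirror[OF sub(1)] vedge_mirror[OF sub(2)])
  have vr: "vedge p y \<in> D \<longleftrightarrow> (if even k then vedge 1 y \<in> C' else vedge p y \<in> C)"
    "vedge p y \<in> D' \<longleftrightarrow> (if even k then vedge 1 y \<in> C else vedge p y \<in> C')" for y
    using p by (simp_all add: D_def D'_def vedge_mirror[OF sub(1)] vedge_mirror[OF sub(2)])
  let ?m = "Suc k * p"
  have J: "ambiguous_pair (?m + p) n (joined ?m y0 R D) (joined ?m y0 R' D')"
    by (intro ambiguous_pair_joined R(1) D, unfold R(2,3) vl y0_def) (use l r in auto)
  have m: "?m + p = Suc (Suc k) * p" by simp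
  note subR = ambiguous_pair_subset[OF R(1)]
  \<comment> \<open>Since \<open>2 \<le> p\<close>, the right border of the appended copy is not the
    column that lost an edge at the seam.\<close>
  have vJ: "vedge (?m + p) y \<in> joined ?m y0 R D \<longleftrightarrow> vedge p y \<in> D"
    "vedge (?m + p) y \<in> joined ?m y0 R' D' \<longleftrightarrow> vedge p y \<in> D'" for y
    using p2 vedge_joined[OF subR(1) subD(1)] vedge_joined[OF subR(2) subD(2)] by auto
  have hJ: "hedge x y \<in> joined ?m y0 R D \<inter> joined ?m y0 R' D'" if "hedge x y \<in> C \<inter> C'" for x y
  proof -
    have "x < ?m" using that hedge_bounds[OF sub(1), of x y] by simp
    then show ?thesis using R(4)[OF that] hedge_joined[OF subR(1) subD(1)] hedge_joined[OF subR(2) subD(2)]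
      by simp
  qed
  show ?case
    unfolding m[symmetric]
    by (intro exI conjI allI impI, rule J, unfold vJ vr) (use hJ in auto)
qed

section \<open>Grids with a side divisible by 4\<close>

text \<open>Form a row of \<open>a\<close> copies, transpose it, and form a row of \<open>b\<close>
  copies of the result. The common edges on the bottom and top border survive in the first row and
  serve as seams of the second.\<close>

lemma ambiguous_pair_tiling:
  assumes C: "ambiguous_pair p r C C'" and pr: "2 \<le> p" "2 \<le> r"
    and edges: "vedge 1 yl \<in> C \<inter> C'" "vedge p yr \<in> C \<inter> C'"
      "hedge xb 1 \<in> C \<inter> C'" "hedge xt r \<in> C \<inter> C'"
    and ab: "1 \<le> a" "1 \<le> b"
  shows "\<exists>R R'. ambiguous_pair (a * p) (b * r) R R'"
proof -
  obtain R R' where R: "ambiguous_pair (Suc (a - 1) * p) r R R'"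
    "\<And>x y. hedge x y \<in> C \<inter> C' \<Longrightarrow> hedge x y \<in> R \<inter> R'"
    using ambiguous_pair_row[OF C pr(1) edges(1,2), of "a - 1"] by blast
  have R': "ambiguous_pair r (a * p) ((`) prod.swap ` R) ((`) prod.swap ` R')"
    using ambiguous_pair_swap[OF R(1)] ab by simp
  note sub = ambiguous_pair_subset[OF R(1)]
  have "vedge 1 xb \<in> (`) prod.swap ` R \<inter> (`) prod.swap ` R'"
    "vedge r xt \<in> (`) prod.swap ` R \<inter> (`) prod.swap ` R'"
    using R(2) edges(3,4) by (auto simp: vedge_swap[OF sub(1)] vedge_swap[OF sub(2)])
  from ambiguous_pair_row[OF R' pr(2) this, of "b - 1"]
  obtain T T' where "ambiguous_pair (Suc (b - 1) * r) (a * p) T T'" by blast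
  then show ?thesis using ambiguous_pair_swap ab by fastforce
qed

lemma unit_step:
  "a' = a + 1 \<Longrightarrow> {(a, b), (a', b)} = hedge a b"
  "a = a' + 1 \<Longrightarrow> {(a, b), (a', b)} = hedge a' b"
  "b' = b + 1 \<Longrightarrow> {(a, b), (a, b')} = vedge a b"
  "b = b' + 1 \<Longrightarrow> {(a, b), (a, b')} = vedge a b'"
  by (auto simp: hedge_def vedge_def)

lemma is_cycleI:
  assumes "length vs \<ge> 3" "distinct vs" "closed_walk_edges vs = C" "C \<subseteq> E"
  shows "is_cycle E C"
  using assms unfolding is_cycle_def by blast

text \<open>\<open>c44'\<close> arises from \<open>c44\<close> by the reflection taking
  \<open>y\<close> to \<open>5 - y\<close>, and \<open>c64'\<close> from \<open>c64\<close>
  likewise.\<close>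

definition c44 :: "(nat \<times> nat) set set" where
  "c44 = {hedge 1 1, hedge 2 1, vedge 3 1, hedge 3 2, vedge 4 2, vedge 4 3,
     hedge 3 4, hedge 2 4, vedge 2 3, hedge 1 3, vedge 1 2, vedge 1 1}"

definition c44' :: "(nat \<times> nat) set set" where
  "c44' = {hedge 1 2, vedge 2 1, hedge 2 1, hedge 3 1, vedge 4 1, vedge 4 2,
     hedge 3 3, vedge 3 3, hedge 2 4, hedge 1 4, vedge 1 3, vedge 1 2}"

lemma ambiguous_pair_c44: "ambiguous_pair 4 4 c44 c44'"
proof -
  have "is_cycle (grid_edges 4 4) c44"
    by (rule is_cycleI[of "[(1,1),(2,1),(3,1),(3,2),(4,2),(4,3),(4,4),(3,4),(2,4),(2,3),(1,3),(1,2)]"])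
      (simp, simp, simp add: closed_walk_edges_Cons unit_step c44_def, simp add: c44_def)
  moreover have "is_cycle (grid_edges 4 4) c44'"
    by (rule is_cycleI[of "[(1,2),(2,2),(2,1),(3,1),(4,1),(4,2),(4,3),(3,3),(3,4),(2,4),(1,4),(1,3)]"])
      (simp, simp, simp add: closed_walk_edges_Cons unit_step c44'_def, simp add: c44'_def)
  moreover have "hedge 1 1 \<in> c44" "hedge 1 1 \<notin> c44'"
    by (simp_all add: c44_def c44'_def)
  moreover have "\<forall>x\<in>{1, 2, 3}. \<forall>y\<in>{1, 2, 3}. cell_count c44 x y = cell_count c44' x y"
    by (simp only: ball_simps simp_thms, simp add: cell_count_def c44_def c44'_def)
  moreover have "{1..<4} = {1, 2, 3 :: nat}" by auto
  ultimately show ?thesis unfolding ambiguous_pair_def signature_eq_iff by metis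
qed

definition c64 :: "(nat \<times> nat) set set" where
  "c64 = {hedge 1 1, hedge 2 1, vedge 3 1, vedge 3 2, hedge 3 3, vedge 4 2, vedge 4 1, hedge 4 1,
     hedge 5 1, vedge 6 1, vedge 6 2, hedge 5 3, vedge 5 3, hedge 4 4, hedge 3 4, hedge 2 4,
     vedge 2 3, hedge 1 3, vedge 1 2, vedge 1 1}"

definition c64' :: "(nat \<times> nat) set set" where
  "c64' = {vedge 1 2, vedge 1 3, hedge 1 4, hedge 2 4, vedge 3 3, vedge 3 2, hedge 3 2, vedge 4 2,
     vedge 4 3, hedge 4 4, hedge 5 4, vedge 6 3, vedge 6 2, hedge 5 2, vedge 5 1, hedge 4 1,
     hedge 3 1, hedge 2 1, vedge 2 1, hedge 1 2}"

lemma ambiguous_pair_c64: "ambiguous_pair 6 4 c64 c64'"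
proof -
  have "is_cycle (grid_edges 6 4) c64"
    by (rule is_cycleI[of "[(1, 1), (2, 1), (3, 1), (3, 2), (3, 3), (4, 3), (4, 2), (4, 1), (5, 1),
        (6, 1), (6, 2), (6, 3), (5, 3), (5, 4), (4, 4), (3, 4), (2, 4), (2, 3), (1, 3), (1, 2)]"])
      (simp, simp, simp add: closed_walk_edges_Cons unit_step c64_def, simp add: c64_def)
  moreover have "is_cycle (grid_edges 6 4) c64'"
    by (rule is_cycleI[of "[(1, 2), (1, 3), (1, 4), (2, 4), (3, 4), (3, 3), (3, 2), (4, 2), (4, 3),
        (4, 4), (5, 4), (6, 4), (6, 3), (6, 2), (5, 2), (5, 1), (4, 1), (3, 1), (2, 1), (2, 2)]"])
      (simp, simp, simp add: closed_walk_edges_Cons unit_step c64'_def, simp add: c64'_def)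
  moreover have "hedge 1 1 \<in> c64" "hedge 1 1 \<notin> c64'"
    by (simp_all add: c64_def c64'_def)
  moreover have "\<forall>x\<in>{1, 2, 3, 4, 5}. \<forall>y\<in>{1, 2, 3}. cell_count c64 x y = cell_count c64' x y"
    by (simp only: ball_simps simp_thms, simp add: cell_count_def c64_def c64'_def)
  moreover have "{1..<4} = {1, 2, 3 :: nat}" "{1..<6} = {1, 2, 3, 4, 5 :: nat}" by auto
  ultimately show ?thesis unfolding ambiguous_pair_def signature_eq_iff by metis
qed

text \<open>Copies of \<open>c44\<close> are put in front, four columns at a time. The left border
  has heights 1 and 2 in \<open>C\<close>, 2 and 3 in \<open>C'\<close>; the right border of
  \<open>c44\<close> and \<open>c44'\<close> is the other way round, so the seam is at height 2. The
  two common horizontal edges are kept for stacking.\<close>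

lemma ambiguous_pair_height_4:
  "\<exists>C C'. ambiguous_pair (2 * k + 4) 4 C C' \<and> vedge 1 1 \<in> C - C' \<and> vedge 1 2 \<in> C \<inter> C' \<and>
     vedge 1 3 \<in> C' - C \<and> hedge 2 1 \<in> C \<inter> C' \<and> hedge 2 4 \<in> C \<inter> C'"
proof (induction k rule: nat_less_induct)
  case (1 k)
  \<comment> \<open>Four more columns raise \<open>k\<close> by 2, so each parity needs a base
    case.\<close>
  consider "k = 0" | "k = 1" | j where "k = j + 2"
    by (metis One_nat_def add_2_eq_Suc' not0_implies_Suc)
  then show ?case
  proof cases
    case 1
    then show ?thesis using ambiguous_pair_c44
      by (intro exI[of _ c44] exI[of _ c44']) (simp add: c44_def c44'_def)
  next
    case 2
    then show ?thesis using ambiguous_pair_c64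
      by (intro exI[of _ c64] exI[of _ c64']) (simp add: c64_def c64'_def)
  next
    case 3
    then obtain C C' where C: "ambiguous_pair (2 * j + 4) 4 C C'" "vedge 1 1 \<in> C - C'"
      "vedge 1 2 \<in> C \<inter> C'" "vedge 1 3 \<in> C' - C"
      using 1 by (metis add_2_eq_Suc' lessI less_Suc_eq)
    note sub = ambiguous_pair_subset[OF C(1)] ambiguous_pair_subset[OF ambiguous_pair_c44]
    have "ambiguous_pair (4 + (2 * j + 4)) 4 (joined 4 2 c44 C) (joined 4 2 c44' C')"
    proof (rule ambiguous_pair_joined[OF ambiguous_pair_c44 _ _ C(1)])
      fix y
      show "of_bool (vedge 4 y \<in> c44) + of_bool (vedge 1 y \<in> C) =
         (of_bool (vedge 4 y \<in> c44') + of_bool (vedge 1 y \<in> C') :: nat)"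
      proof (cases "1 \<le> y \<and> y < 4")
        case True
        then consider "y = 1" | "y = 2" | "y = 3" by linarith
        then show ?thesis using C(2-4) by cases (simp_all add: c44_def c44'_def)
      next
        case False
        then show ?thesis
          using vedge_bounds[OF sub(1), of 1 y] vedge_bounds[OF sub(2), of 1 y]
            vedge_bounds[OF sub(3), of 4 y] vedge_bounds[OF sub(4), of 4 y] by auto
      qed
    qed (use C(3) in \<open>auto simp: c44_def c44'_def\<close>)
    moreover have "4 + (2 * j + 4) = 2 * k + 4" using 3 by simp
    ultimately show ?thesis
      by (intro exI[of _ "joined 4 2 c44 C"] exI[of _ "joined 4 2 c44' C'"])
        (simp add: hedge_joined[OF sub(3,1)] hedge_joined[OF sub(4,2)]
          vedge_joined[OF sub(3,1)] vedge_joined[OF sub(4,2)], simp add: c44_def c44'_def)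
  qed
qed

text \<open>Strips of height 4 and length \<open>n\<close> are turned upright and set side by side;
  the common edges in their first and last rows become the seams.\<close>

lemma ambiguous_pair_four_dvd:
  assumes "4 dvd m" "even n" "m > 0" "n \<ge> 4"
  shows "\<exists>R R'. ambiguous_pair m n R R'"
proof -
  obtain a where a: "m = a * 4" using assms(1) by (metis dvdE mult.commute)
  have n: "n = 2 * ((n - 4) div 2) + 4" using assms by auto
  obtain C C' where C: "ambiguous_pair n 4 C C'" "hedge 2 1 \<in> C \<inter> C'" "hedge 2 4 \<in> C \<inter> C'"
    using ambiguous_pair_height_4[of "(n - 4) div 2"] n by metis
  note sub = ambiguous_pair_subset[OF C(1)]
  have "vedge 1 2 \<in> (`) prod.swap ` C \<inter> (`) prod.swap ` C'"
    "vedge 4 2 \<in> (`) prod.swap ` C \<inter> (`) prod.swap ` C'"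
    using C(2,3) by (auto simp: vedge_swap[OF sub(1)] vedge_swap[OF sub(2)])
  from ambiguous_pair_row[OF ambiguous_pair_swap[OF C(1)] _ this, of "a - 1"]
  obtain R R' where "ambiguous_pair (Suc (a - 1) * 4) n R R'" by auto
  then show ?thesis using a assms(3) by auto
qed

section \<open>Squares of odd side\<close>

text \<open>
  The first cycle of a square of odd side \<open>q\<close> passes through the diagonal vertices \<open>(i, i)\<close> with
  \<open>i < q\<close>, leaving each of them upwards and to the right; its image under reflection in the other
  diagonal agrees with it away from the diagonal, and at the diagonal it has the downward and
  leftward edges instead. Above the diagonal the vertices \<open>(i, i + 1)\<close> are linked in the pairs
  1-2, 3-4, and so on; below it the vertices \<open>(i + 1, i)\<close> are linked in the pairs 2-3, 4-5, and so
  on, the first and the last being linked along the border.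
\<close>

fun zigzag :: "nat \<Rightarrow> (nat \<times> nat) list" where
  "zigzag 0 = []"
| "zigzag (Suc k) = zigzag k @
    [(2*k+1, 2*k+1), (2*k+1, 2*k+2), (2*k+1, 2*k+3), (2*k+2, 2*k+3),
     (2*k+2, 2*k+2), (2*k+3, 2*k+2), (2*k+4, 2*k+2), (2*k+4, 2*k+3)]"

lemma hd_zigzag: "hd (zigzag k @ (2*k+1, 2*k+1) # xs) = (1, 1)"
proof (induction k arbitrary: xs)
  case (Suc k)
  then show ?case by simp
qed simp

lemma zigzag_bounds:
  assumes "(x, y) \<in> set (zigzag k)"
  shows "x \<le> 2*k+2" "y \<le> 2*k+1" "x = 2*k+1 \<Longrightarrow> y \<noteq> 2*k+1" "y = 1 \<Longrightarrow> x = 1"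
  using assms by (induction k) auto

lemma notin_zigzag:
  "2*k+2 < x \<or> 2*k+1 < y \<or> x = 2*k+1 \<and> y = 2*k+1 \<or> y = 1 \<and> x \<noteq> 1 \<Longrightarrow> (x, y) \<notin> set (zigzag k)"
  using zigzag_bounds[of x y k] by linarith

lemma distinct_zigzag: "distinct (zigzag k)"
proof (induction k)
  case (Suc k)
  then show ?case by (auto simp: notin_zigzag)
qed simp

lemma zigzag_edges:
  "(hedge x y \<in> path_edges (zigzag k @ [(2*k+1, 2*k+1)]) \<longleftrightarrow>
     y = x \<and> 2 \<le> x \<and> x \<le> 2*k+1 \<or> y = x + 2 \<and> odd x \<and> x \<le> 2*k \<or>
     x = y + 1 \<and> even y \<and> 2 \<le> y \<and> y \<le> 2*k) \<and>
   (vedge x y \<in> path_edges (zigzag k @ [(2*k+1, 2*k+1)]) \<longleftrightarrow>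
     y = x \<and> 1 \<le> x \<and> x \<le> 2*k \<or> y = x + 1 \<and> odd x \<and> x \<le> 2*k \<or>
     x = y + 2 \<and> even y \<and> 2 \<le> y \<and> y \<le> 2*k) \<and>
   (\<forall>e\<in>path_edges (zigzag k @ [(2*k+1, 2*k+1)]). \<exists>x y. e = hedge x y \<or> e = vedge x y)"
proof (induction k)
  case 0
  then show ?case by auto
next
  case (Suc k)
  let ?e = "(2 * Suc k + 1, 2 * Suc k + 1) :: nat \<times> nat"
  have ee: "?e = (2*k+3, 2*k+3)" by simp
  have "path_edges (zigzag (Suc k) @ [?e]) = path_edges (zigzag k @ [(2*k+1, 2*k+1)]) \<union>
    path_edges [(2*k+1, 2*k+1), (2*k+1, 2*k+2), (2*k+1, 2*k+3), (2*k+2, 2*k+3),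
      (2*k+2, 2*k+2), (2*k+3, 2*k+2), (2*k+4, 2*k+2), (2*k+4, 2*k+3), (2*k+3, 2*k+3)]"
    unfolding ee zigzag.simps append_assoc append_Cons append_Nil by (rule path_edges_append)
  also have "path_edges [(2*k+1, 2*k+1), (2*k+1, 2*k+2), (2*k+1, 2*k+3), (2*k+2, 2*k+3),
      (2*k+2, 2*k+2), (2*k+3, 2*k+2), (2*k+4, 2*k+2), (2*k+4, 2*k+3), (2*k+3, 2*k+3)] =
    {vedge (2*k+1) (2*k+1), vedge (2*k+1) (2*k+2), hedge (2*k+1) (2*k+3), vedge (2*k+2) (2*k+2),
     hedge (2*k+2) (2*k+2), hedge (2*k+3) (2*k+2), vedge (2*k+4) (2*k+2), hedge (2*k+3) (2*k+3)}"
    by (simp add: unit_step)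
  finally have e: "path_edges (zigzag (Suc k) @ [?e]) = path_edges (zigzag k @ [(2*k+1, 2*k+1)]) \<union>
    {vedge (2*k+1) (2*k+1), vedge (2*k+1) (2*k+2), hedge (2*k+1) (2*k+3), vedge (2*k+2) (2*k+2),
     hedge (2*k+2) (2*k+2), hedge (2*k+3) (2*k+2), vedge (2*k+4) (2*k+2), hedge (2*k+3) (2*k+3)}" .
  show ?case unfolding e Un_iff Suc[THEN conjunct1] Suc[THEN conjunct2, THEN conjunct1]
  proof (intro conjI, goal_cases)
    case 1
    \<comment> \<open>All edges lie on a few diagonals; fixing the diagonal leaves a Presburger
      statement in \<open>k\<close> and one coordinate.\<close>
    consider "y = x" | "y = x + 2" | "x = y + 1" | "y \<noteq> x" "y \<noteq> x + 2" "x \<noteq> y + 1" by blast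
    then show ?case
    proof cases
      case 1 then show ?thesis by simp presburger
    next
      case 2 then show ?thesis by simp presburger
    next
      case 3 then show ?thesis by simp presburger
    next
      case 4 then show ?thesis by auto
    qed
  next
    case 2
    consider "y = x" | "y = x + 1" | "x = y + 2" | "y \<noteq> x" "y \<noteq> x + 1" "x \<noteq> y + 2" by blast
    then show ?case
    proof cases
      case 1 then show ?thesis by simp presburger
    next
      case 2 then show ?thesis by simp presburger
    next
      case 3 then show ?thesis by simp presburger
    next
      case 4 then show ?thesis by auto
    qed
  next
    case 3
    then show ?case using Suc[THEN conjunct2, THEN conjunct2] by (simp add: ball_Un)
  qed
qed

lemma vertical_path_edges: "path_edges (map (Pair a) [l..<u]) = {vedge a y |y. l \<le> y \<and> Suc y < u}"
proof -
  have "path_edges (map (Pair a) [l..<u]) = {vedge a (l + i) |i. Suc (l + i) < u}"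
    unfolding path_edges_conv_nth vedge_def by (intro Collect_cong ex_cong1) auto
  also have "\<dots> = {vedge a y |y. l \<le> y \<and> Suc y < u}"
    by (metis (no_types, opaque_lifting) le_add1 le_iff_add)
  finally show ?thesis .
qed

lemma horizontal_path_edges:
  "path_edges (map (\<lambda>x. (x, b)) [l..<u]) = {hedge x b |x. l \<le> x \<and> Suc x < u}"
proof -
  have "path_edges (map (\<lambda>x. (x, b)) [l..<u]) = {hedge (l + i) b |i. Suc (l + i) < u}"
    unfolding path_edges_conv_nth hedge_def by (intro Collect_cong ex_cong1) auto
  also have "\<dots> = {hedge x b |x. l \<le> x \<and> Suc x < u}"
    by (metis (no_types, opaque_lifting) le_add1 le_iff_add)
  finally show ?thesis .
qed

text \<open>After its last link above the diagonal the walk turns into the right border, runs down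
  it and returns along the bottom row. With \<open>q = 2*k+3\<close>, the corner
  \<open>(q, q)\<close> is not visited.\<close>

definition odd_walk :: "nat \<Rightarrow> (nat \<times> nat) list" where
  "odd_walk k = zigzag k @
     [(2*k+1, 2*k+1), (2*k+1, 2*k+2), (2*k+1, 2*k+3), (2*k+2, 2*k+3), (2*k+2, 2*k+2)] @
     map (Pair (2*k+3)) (rev [1..<2*k+3]) @ map (\<lambda>x. (x, 1)) (rev [2..<2*k+3])"

lemma distinct_odd_walk: "distinct (odd_walk k)"
  unfolding odd_walk_def using distinct_zigzag[of k]
  by (auto simp: distinct_map inj_on_def notin_zigzag)

text \<open>The edges shared by the cycle and its reflection: in turn the links above the diagonal,
  the links below it, and the border. \<open>vcommon\<close> is arranged alike.\<close>

definition hcommon :: "nat \<Rightarrow> nat \<Rightarrow> nat \<Rightarrow> bool" where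
  "hcommon q x y \<longleftrightarrow> y = x + 2 \<and> odd x \<and> x + 2 \<le> q \<or> x = y + 1 \<and> even y \<and> 2 \<le> y \<and> x + 2 \<le> q \<or>
     y = 1 \<and> 2 \<le> x \<and> x < q"

definition vcommon :: "nat \<Rightarrow> nat \<Rightarrow> nat \<Rightarrow> bool" where
  "vcommon q x y \<longleftrightarrow> y = x + 1 \<and> odd x \<and> x + 2 \<le> q \<or> x = y + 2 \<and> even y \<and> 2 \<le> y \<and> x + 1 \<le> q \<or>
     x = q \<and> 1 \<le> y \<and> y + 1 < q"

lemma odd_walk_edges:
  fixes k defines "q \<equiv> 2 * k + 3"
  shows "hedge x y \<in> closed_walk_edges (odd_walk k) \<longleftrightarrow> hcommon q x y \<or> y = x \<and> 1 \<le> x \<and> x < q"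
    and "vedge x y \<in> closed_walk_edges (odd_walk k) \<longleftrightarrow> vcommon q x y \<or> y = x \<and> 1 \<le> x \<and> x < q"
    and "e \<in> closed_walk_edges (odd_walk k) \<Longrightarrow> \<exists>x y. e = hedge x y \<or> e = vedge x y"
proof -
  let ?f = "[(2*k+1, 2*k+1), (2*k+1, 2*k+2), (2*k+1, 2*k+3), (2*k+2, 2*k+3), (2*k+2, 2*k+2)]"
  let ?r = "map (Pair (2*k+3)) (rev [1..<2*k+2])"
  let ?b = "map (\<lambda>x. (x, 1 :: nat)) (rev [1..<2*k+4])"
  have "hd (odd_walk k) = (1, 1)"
    unfolding odd_walk_def using hd_zigzag[of k] by simp
  then obtain vs where vs: "odd_walk k = (1, 1) # vs"
    by (cases "odd_walk k") (auto simp: odd_walk_def)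
  have "[1..<Suc (2*k+2)] = [1..<2*k+2] @ [2*k+2]" "[1..<Suc (2*k+3)] = [1..<2*k+3] @ [2*k+3]"
    by (rule upt_Suc_append, simp)+
  moreover have "Suc (2*k+2) = 2*k+3" "Suc (2*k+3) = 2*k+4" by simp_all
  ultimately have u: "[1..<2*k+3] = [1..<2*k+2] @ [2*k+2]" "[1..<2*k+4] = [1..<2*k+3] @ [2*k+3]"
    by metis+
  have u2: "[1..<2*k+3] = 1 # [2..<2*k+3]"
    using upt_conv_Cons[of 1 "2*k+3"] unfolding Suc_1 by simp
  \<comment> \<open>The run down the right border is split off at its top vertex and again at the
    corner \<open>(q, 1)\<close>, so that each straight run becomes a path of its own.\<close>
  have r: "map (Pair (2*k+3)) (rev [1..<2*k+3]) = (2*k+3, 2*k+2) # ?r"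
    unfolding u by simp
  have r': "map (Pair (2*k+3)) (rev [1..<2*k+3]) = map (Pair (2*k+3)) (rev [2..<2*k+3]) @ [(2*k+3, 1)]"
    unfolding u2 by simp
  have b: "?b = (2*k+3, 1) # map (\<lambda>x. (x, 1)) (rev [2..<2*k+3]) @ [(1, 1)]"
    unfolding u(2) unfolding u2 by simp
  have "closed_walk_edges (odd_walk k) = path_edges (odd_walk k @ [(1, 1)])"
    unfolding vs closed_walk_edges_Cons by simp
  also have "odd_walk k @ [(1, 1)] =
     (zigzag k @ ?f @ map (Pair (2*k+3)) (rev [2..<2*k+3])) @ (2*k+3, 1) # map (\<lambda>x. (x, 1)) (rev [2..<2*k+3]) @ [(1, 1)]"
    unfolding odd_walk_def r' by simp
  also have "path_edges \<dots> = path_edges (zigzag k @ ?f @ map (Pair (2*k+3)) (rev [1..<2*k+3])) \<union> path_edges ?b"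
    unfolding b by (subst path_edges_append) (simp only: r' append_assoc)
  also have "path_edges (zigzag k @ ?f @ map (Pair (2*k+3)) (rev [1..<2*k+3])) =
      path_edges ((zigzag k @ ?f) @ (2*k+3, 2*k+2) # ?r)"
    unfolding r by simp
  also have "\<dots> = path_edges (zigzag k @ (2*k+1, 2*k+1) # tl ?f @ [(2*k+3, 2*k+2)]) \<union> path_edges ((2*k+3, 2*k+2) # ?r)"
    by (subst path_edges_append) simp
  also have "path_edges (zigzag k @ (2*k+1, 2*k+1) # tl ?f @ [(2*k+3, 2*k+2)]) =
      path_edges (zigzag k @ [(2*k+1, 2*k+1)]) \<union> path_edges ((2*k+1, 2*k+1) # tl ?f @ [(2*k+3, 2*k+2)])"
    by (rule path_edges_append)
  also have "path_edges ((2*k+1, 2*k+1) # tl ?f @ [(2*k+3, 2*k+2)]) = {vedge (2*k+1) (2*k+1),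
     vedge (2*k+1) (2*k+2), hedge (2*k+1) (2*k+3), vedge (2*k+2) (2*k+2), hedge (2*k+2) (2*k+2)}"
    by (simp add: unit_step)
  also have "path_edges ((2*k+3, 2*k+2) # ?r) = {vedge (2*k+3) y |y. 1 \<le> y \<and> Suc y < 2*k+3}"
    unfolding r[symmetric] unfolding rev_map[symmetric] path_edges_rev vertical_path_edges ..
  also have "path_edges ?b = {hedge x 1 |x. 1 \<le> x \<and> Suc x < 2*k+4}"
    unfolding rev_map[symmetric] path_edges_rev horizontal_path_edges ..
  finally have e: "closed_walk_edges (odd_walk k) = path_edges (zigzag k @ [(2*k+1, 2*k+1)]) \<union>
    {vedge (2*k+1) (2*k+1), vedge (2*k+1) (2*k+2), hedge (2*k+1) (2*k+3), vedge (2*k+2) (2*k+2),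
     hedge (2*k+2) (2*k+2)} \<union> {vedge (2*k+3) y |y. 1 \<le> y \<and> Suc y < 2*k+3} \<union>
     {hedge x 1 |x. 1 \<le> x \<and> Suc x < 2*k+4}" .
  show "hedge x y \<in> closed_walk_edges (odd_walk k) \<longleftrightarrow> hcommon q x y \<or> y = x \<and> 1 \<le> x \<and> x < q"
  proof -
    consider "y = x" | "y = x + 2" | "x = y + 1" | "y \<noteq> x" "y \<noteq> x + 2" "x \<noteq> y + 1" by blast
    then show ?thesis
    proof cases
      case 1 then show ?thesis
        unfolding e Un_iff zigzag_edges[THEN conjunct1] hcommon_def q_def by simp presburger
    next
      case 2 then show ?thesis
        unfolding e Un_iff zigzag_edges[THEN conjunct1] hcommon_def q_def by simp presburger
    next
      case 3 then show ?thesis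
        unfolding e Un_iff zigzag_edges[THEN conjunct1] hcommon_def q_def by simp presburger
    next
      case 4 then show ?thesis
        unfolding e Un_iff zigzag_edges[THEN conjunct1] hcommon_def q_def by auto
    qed
  qed
  show "vedge x y \<in> closed_walk_edges (odd_walk k) \<longleftrightarrow> vcommon q x y \<or> y = x \<and> 1 \<le> x \<and> x < q"
  proof -
    consider "y = x" | "y = x + 1" | "x = y + 2" | "y \<noteq> x" "y \<noteq> x + 1" "x \<noteq> y + 2" by blast
    then show ?thesis
    proof cases
      case 1 then show ?thesis
        unfolding e Un_iff zigzag_edges[THEN conjunct2, THEN conjunct1] vcommon_def q_def by simp presburger
    next
      case 2 then show ?thesis
        unfolding e Un_iff zigzag_edges[THEN conjunct2, THEN conjunct1] vcommon_def q_def by simp presburger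
    next
      case 3 then show ?thesis
        unfolding e Un_iff zigzag_edges[THEN conjunct2, THEN conjunct1] vcommon_def q_def by simp presburger
    next
      case 4 then show ?thesis
        unfolding e Un_iff zigzag_edges[THEN conjunct2, THEN conjunct1] vcommon_def q_def by auto
    qed
  qed
  show "\<exists>x y. e = hedge x y \<or> e = vedge x y" if "e \<in> closed_walk_edges (odd_walk k)"
    using that zigzag_edges[THEN conjunct2, THEN conjunct2] unfolding e by blast
qed


lemma ambiguous_pair_odd_square:
  fixes k defines "q \<equiv> 2 * k + 3"
  shows "\<exists>C C'. ambiguous_pair q q C C' \<and> vedge 1 2 \<in> C \<inter> C' \<and> vedge q 1 \<in> C \<inter> C' \<and>
    hedge 2 1 \<in> C \<inter> C' \<and> hedge (q - 2) q \<in> C \<inter> C'"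
proof -
  define C where "C = closed_walk_edges (odd_walk k)"
  \<comment> \<open>The composition takes \<open>(x, y)\<close> to
    \<open>(q + 1 - y, q + 1 - x)\<close>, the reflection in the other diagonal.\<close>
  define C' where "C' = (`) (mirror q) ` (`) prod.swap ` (`) (mirror q) ` C"
  have hC: "hedge x y \<in> C \<longleftrightarrow> hcommon q x y \<or> y = x \<and> 1 \<le> x \<and> x < q"
    and vC: "vedge x y \<in> C \<longleftrightarrow> vcommon q x y \<or> y = x \<and> 1 \<le> x \<and> x < q" for x y
    unfolding C_def q_def by (rule odd_walk_edges)+
  have q: "odd q" "3 \<le> q" unfolding q_def by simp_all
  have sub: "C \<subseteq> grid_edges q q"
  proof
    fix e assume "e \<in> C"
    then obtain x y where "e = hedge x y \<and> hedge x y \<in> C \<or> e = vedge x y \<and> vedge x y \<in> C"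
      using odd_walk_edges(3) unfolding C_def by blast
    then show "e \<in> grid_edges q q"
      using q odd_pos[of x] unfolding hC vC hcommon_def vcommon_def by auto
  qed
  have cyc: "is_cycle (grid_edges q q) C"
    using distinct_odd_walk sub unfolding C_def
    by (intro is_cycleI[of "odd_walk k"]) (simp_all add: odd_walk_def)
  have cyc': "is_cycle (grid_edges q q) C'"
    unfolding C'_def using cyc by (intro is_cycle_mirror is_cycle_swap)
  note sub1 = is_cycle_mirror[OF cyc, THEN is_cycle_subset]
  note sub2 = is_cycle_swap[OF is_cycle_mirror[OF cyc], THEN is_cycle_subset]
  have hC': "hedge x y \<in> C' \<longleftrightarrow> hcommon q x y \<or> y = x + 1 \<and> 1 \<le> x \<and> x < q" for x y
  proof -
    have "hedge x y \<in> C' \<longleftrightarrow> x < q \<and> y \<le> q \<and> vedge (q + 1 - y) (q - x) \<in> C"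
      unfolding C'_def hedge_mirror[OF sub2] hedge_swap[OF sub1] vedge_mirror[OF sub] by blast
    also have "\<dots> \<longleftrightarrow> hcommon q x y \<or> y = x + 1 \<and> 1 \<le> x \<and> x < q"
    proof (cases "x < q \<and> y \<le> q")
      case True
      \<comment> \<open>Complementary coordinates replace truncated differences; oddness of
        \<open>q\<close> makes the parity conditions on the links survive the reflection.\<close>
      define a b where "a = q - x" "b = q - y"
      then have ab: "q = x + a" "1 \<le> a" "q = y + b" using True by auto
      then have "q - x = a" "q + 1 - y = b + 1" by simp_all
      moreover have "a = b + 1 + 1 \<and> odd (b + 1) \<and> b + 1 + 2 \<le> q \<longleftrightarrow> y = x + 2 \<and> odd x \<and> x + 2 \<le> q"
        using ab q(1) by presburger
      moreover have "b + 1 = a + 2 \<and> even a \<and> 2 \<le> a \<and> b + 1 + 1 \<le> q \<longleftrightarrow>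
          x = y + 1 \<and> even y \<and> 2 \<le> y \<and> x + 2 \<le> q"
        using ab q(1) by presburger
      moreover have "b + 1 = q \<and> 1 \<le> a \<and> a + 1 < q \<longleftrightarrow> y = 1 \<and> 2 \<le> x \<and> x < q"
        using ab by auto
      moreover have "a = b + 1 \<and> 1 \<le> b + 1 \<and> b + 1 < q \<longleftrightarrow> y = x + 1 \<and> 1 \<le> x \<and> x < q"
        using ab by auto
      ultimately show ?thesis using True unfolding vC vcommon_def hcommon_def by simp
    next
      case False
      then show ?thesis unfolding hcommon_def using q by auto
    qed
    finally show ?thesis .
  qed
  have vC': "vedge x y \<in> C' \<longleftrightarrow> vcommon q x y \<or> x = y + 1 \<and> 1 \<le> y \<and> y < q" for x y
  proof -
    have "vedge x y \<in> C' \<longleftrightarrow> x \<le> q \<and> y < q \<and> hedge (q - y) (q + 1 - x) \<in> C"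
      unfolding C'_def vedge_mirror[OF sub2] vedge_swap[OF sub1] hedge_mirror[OF sub] by blast
    also have "\<dots> \<longleftrightarrow> vcommon q x y \<or> x = y + 1 \<and> 1 \<le> y \<and> y < q"
    proof (cases "x \<le> q \<and> y < q")
      case True
      define a b where "a = q - x" "b = q - y"
      then have ab: "q = x + a" "1 \<le> b" "q = y + b" using True by auto
      then have "q - y = b" "q + 1 - x = a + 1" by simp_all
      moreover have "a + 1 = b + 2 \<and> odd b \<and> b + 2 \<le> q \<longleftrightarrow> y = x + 1 \<and> odd x \<and> x + 2 \<le> q"
        using ab q(1) by presburger
      moreover have "b = a + 1 + 1 \<and> even (a + 1) \<and> 2 \<le> a + 1 \<and> b + 2 \<le> q \<longleftrightarrow>
          x = y + 2 \<and> even y \<and> 2 \<le> y \<and> x + 1 \<le> q"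
        using ab q(1) by presburger
      moreover have "a + 1 = 1 \<and> 2 \<le> b \<and> b < q \<longleftrightarrow> x = q \<and> 1 \<le> y \<and> y + 1 < q"
        using ab by auto
      moreover have "a + 1 = b \<and> 1 \<le> b \<and> b < q \<longleftrightarrow> x = y + 1 \<and> 1 \<le> y \<and> y < q"
        using ab by auto
      ultimately show ?thesis using True unfolding hC vcommon_def hcommon_def by simp
    next
      case False
      then show ?thesis unfolding vcommon_def using q by auto
    qed
    finally show ?thesis .
  qed
  \<comment> \<open>A diagonal cell has its bottom and left edges in \<open>C\<close>, its top and
    right edges in \<open>C'\<close>. A cell next to the diagonal trades one edge for another, and
    every other cell has the same edges in both.\<close>
  have "cell_count C x y = cell_count C' x y" if "x \<in> {1..<q}" "y \<in> {1..<q}" for x y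
  proof -
    consider "x = y" | "y = x + 1" | "x = y + 1" | "x \<noteq> y" "y \<noteq> x + 1" "x \<noteq> y + 1" by blast
    then show ?thesis
      using that by cases (auto simp: cell_count_def hC vC hC' vC' hcommon_def vcommon_def)
  qed
  moreover have "hedge 1 1 \<in> C" "hedge 1 1 \<notin> C'"
    using q unfolding hC hC' hcommon_def by auto
  ultimately have "ambiguous_pair q q C C'"
    using cyc cyc' unfolding ambiguous_pair_def signature_eq_iff by blast
  moreover have "vedge 1 2 \<in> C \<inter> C'" "vedge q 1 \<in> C \<inter> C'" "hedge 2 1 \<in> C \<inter> C'" "hedge (q - 2) q \<in> C \<inter> C'"
    using q unfolding Int_iff hC vC hC' vC' hcommon_def vcommon_def by auto
  ultimately show ?thesis by blast
qed

lemma ambiguous_pair_odd_dvd: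
  assumes "odd q" "3 \<le> q" "q dvd m" "q dvd n" "m > 0" "n > 0"
  shows "\<exists>R R'. ambiguous_pair m n R R'"
proof -
  obtain a b where ab: "m = a * q" "n = b * q" using assms(3,4) by (metis dvdE mult.commute)
  have q: "q = 2 * ((q - 3) div 2) + 3" using assms(1,2) by presburger
  obtain C C' where "ambiguous_pair q q C C'" "vedge 1 2 \<in> C \<inter> C'" "vedge q 1 \<in> C \<inter> C'"
    "hedge 2 1 \<in> C \<inter> C'" "hedge (q - 2) q \<in> C \<inter> C'"
    using ambiguous_pair_odd_square[of "(q - 3) div 2"] q by metis
  from ambiguous_pair_tiling[OF this(1) _ _ this(2-5), of a b] show ?thesis
    using ab assms by (auto simp: Suc_le_eq)
qed

text \<open>If the gcd has an odd divisor of at least 3, squares of that side tile the grid.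
  Otherwise it is a power of 2, so both sides are even and one of them is divisible by 4, by
  hypothesis in case the gcd is 2.\<close>

lemma ambiguous_pair_exists:
  assumes "3 \<le> m" "3 \<le> n" "gcd m n \<ge> 2" "gcd m n = 2 \<Longrightarrow> 4 dvd m \<or> 4 dvd n"
  shows "\<exists>R R'. ambiguous_pair m n R R'"
proof (cases "\<exists>q. odd q \<and> 3 \<le> q \<and> q dvd gcd m n")
  case True
  then obtain q where "odd q" "3 \<le> q" "q dvd gcd m n" by blast
  then show ?thesis using ambiguous_pair_odd_dvd[of q m n] assms(1,2) by auto
next
  case False
  have "odd e \<Longrightarrow> e dvd gcd m n \<Longrightarrow> e = 1" for e
    using False by (metis One_nat_def Suc_leI dvd_0_right even_zero le_antisym not_less_eq_eq numeral_2_eq_2 numeral_3_eq_3 odd_pos even_numeral)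
  then have "even (gcd m n)" using assms(3) by (metis dvd_refl numeral_le_one_iff semiring_norm(69))
  then obtain e where e: "gcd m n = 2 * e" by blast
  have "4 dvd m \<or> 4 dvd n"
  proof (cases "even e")
    case True
    then have "4 dvd gcd m n" unfolding e by auto
    then show ?thesis by auto
  next
    case odd: False
    then have "e = 1" using \<open>\<And>e. odd e \<Longrightarrow> e dvd gcd m n \<Longrightarrow> e = 1\<close> e by simp
    then show ?thesis using assms(4) e by simp
  qed
  moreover have "even m" "even n" using \<open>even (gcd m n)\<close> by auto
  moreover have "n \<noteq> 3" "m \<noteq> 3" using \<open>even m\<close> \<open>even n\<close> by auto
  ultimately show ?thesis
    using ambiguous_pair_four_dvd[of m n] ambiguous_pair_four_dvd[of n m] ambiguous_pair_swap assms(1,2)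
    by (metis One_nat_def Suc_le_eq eval_nat_numeral(2) le_neq_implies_less numeral_3_eq_3 less_le_trans semiring_norm(26,27) zero_less_numeral)
qed

section \<open>Degrees, and the wave equation modulo 2\<close>

text \<open>Cut the cycle at an edge \<open>{v, b}\<close>: the remaining path starts at
  \<open>v\<close>, and its first step is the only other edge there.\<close>

lemma cycle_neighbours:
  assumes "is_cycle E C" "v \<in> \<Union> C"
  obtains u w where "u \<noteq> w" "\<And>z. {v, z} \<in> C \<longleftrightarrow> z = u \<or> z = w"
proof -
  obtain vs where vs: "distinct vs" "C = closed_walk_edges vs"
    using assms(1) unfolding is_cycle_def by blast
  have "\<exists>b. {v, b} \<in> C"
    using assms(2) unfolding vs closed_walk_edges_def by (auto simp: insert_commute)
  then obtain b where b: "{v, b} \<in> C" by blast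
  obtain xs where xs: "distinct (v # xs @ [b])" "C = insert {v, b} (path_edges (v # xs @ [b]))" "xs \<noteq> []"
    using is_cycle_cut_edge[OF assms(1) b] by metis
  obtain z zs where z: "xs = z # zs" using xs(3) by (cases xs) auto
  have "{v, t} \<notin> path_edges (z # zs @ [b])" for t
    using path_edges_subset[of "{v, t}" "z # zs @ [b]"] xs(1) z by auto
  then have "{v, t} \<in> C \<longleftrightarrow> t = b \<or> t = z" for t
    unfolding xs(2) z by (auto simp: doubleton_eq_iff)
  moreover have "b \<noteq> z" using xs(1) z by auto
  ultimately show ?thesis using that by blast
qed

text \<open>The degree, laid out like \<open>cell_count\<close>. At coordinate 1 the term with the
  difference is a segment starting at coordinate 0, outside the grid.\<close>

definition vertex_count :: "(nat \<times> nat) set set \<Rightarrow> nat \<Rightarrow> nat \<Rightarrow> nat" where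
  "vertex_count C x y = of_bool (hedge (x - 1) y \<in> C) + of_bool (hedge x y \<in> C)
     + of_bool (vedge x (y - 1) \<in> C) + of_bool (vedge x y \<in> C)"

lemma vertex_edges:
  assumes "1 \<le> x" "1 \<le> y"
  shows "hedge (x - 1) y = {(x, y), (x - 1, y)}" "hedge x y = {(x, y), (x + 1, y)}"
    "vedge x (y - 1) = {(x, y), (x, y - 1)}" "vedge x y = {(x, y), (x, y + 1)}"
  using assms by (auto simp: hedge_def vedge_def)

lemma grid_edge_neighbour:
  assumes "{(x, y), z} \<in> grid_edges m n"
  shows "z \<in> {(x - 1, y), (x + 1, y), (x, y - 1), (x, y + 1)}"
  using assms unfolding grid_edges_def unit_segments_def grid_vertices_def
  by (auto simp: doubleton_eq_iff)

lemma vertex_count_cycle: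
  assumes C: "is_cycle (grid_edges m n) C" and xy: "1 \<le> x" "1 \<le> y"
  shows "vertex_count C x y = (if (x, y) \<in> \<Union> C then 2 else 0)"
proof (cases "(x, y) \<in> \<Union> C")
  case True
  from cycle_neighbours[OF C True] obtain u w
    where uw: "u \<noteq> w" "\<And>z. {(x, y), z} \<in> C \<longleftrightarrow> z = u \<or> z = w" by metis
  have "{(x, y), u} \<in> grid_edges m n" "{(x, y), w} \<in> grid_edges m n"
    using uw(2) is_cycle_subset[OF C] by blast+
  then have "u \<in> {(x - 1, y), (x + 1, y), (x, y - 1), (x, y + 1)}"
    "w \<in> {(x - 1, y), (x + 1, y), (x, y - 1), (x, y + 1)}"
    using grid_edge_neighbour by blast+
  moreover obtain a b where "x = Suc a" "y = Suc b" using xy by (metis Suc_le_D One_nat_def)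
  ultimately have "vertex_count C x y = 2"
    unfolding vertex_count_def vertex_edges[OF xy] uw(2) using uw(1)
    by (elim insertE emptyE) simp_all
  then show ?thesis using True by simp
next
  case False
  then have "e \<notin> C" if "(x, y) \<in> e" for e using that by blast
  then have "vertex_count C x y = 0"
    unfolding vertex_count_def vertex_edges[OF xy] by simp
  then show ?thesis using False by simp
qed

text \<open>The zigzag of period \<open>4 * m\<close> that unfolds reflections at the walls \<open>0\<close> and \<open>2 * m\<close>.\<close>

definition fold_wall :: "nat \<Rightarrow> int \<Rightarrow> int" where
  "fold_wall m P = (let r = P mod (4 * int m) in if r \<le> 2 * int m then r else 4 * int m - r)"

lemma fold_wall_bounds: "m > 0 \<Longrightarrow> 0 \<le> fold_wall m P" "m > 0 \<Longrightarrow> fold_wall m P \<le> 2 * int m"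
proof -
  show "0 \<le> fold_wall m P" if "m > 0"
    using that pos_mod_bound[of "4 * int m" P] pos_mod_sign[of "4 * int m" P]
    unfolding fold_wall_def Let_def by (auto intro: less_imp_le)
  show "fold_wall m P \<le> 2 * int m" if "m > 0"
    unfolding fold_wall_def Let_def by auto
qed

lemma fold_wall_id: "0 \<le> P \<Longrightarrow> P \<le> 2 * int m \<Longrightarrow> m > 0 \<Longrightarrow> fold_wall m P = P"
  unfolding fold_wall_def by (simp add: mod_pos_pos_trivial)

lemma fold_wall_period: "fold_wall m (P + 4 * int m) = fold_wall m P"
  unfolding fold_wall_def by simp

lemma fold_wall_minus: "m > 0 \<Longrightarrow> fold_wall m (- P) = fold_wall m P"
  using pos_mod_bound[of "4 * int m" P] pos_mod_sign[of "4 * int m" P]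
  unfolding fold_wall_def Let_def zmod_zminus1_eq_if by auto

lemma even_fold_wall: "even (fold_wall m P) \<longleftrightarrow> even P"
proof -
  have "even (P mod (4 * int m)) \<longleftrightarrow> even P" by (simp add: dvd_mod_iff)
  then show ?thesis unfolding fold_wall_def Let_def by auto
qed

text \<open>Between the walls, the neighbours of \<open>P\<close> fold to the neighbours of its
  image, in one order or the other; at a wall they fold together. This carries the wave equation
  over to the unfolded plane.\<close>

lemma fold_wall_neighbours:
  assumes "m > 0"
  shows "0 < fold_wall m P \<and> fold_wall m P < 2 * int m \<Longrightarrow>
      {fold_wall m (P - 1), fold_wall m (P + 1)} = {fold_wall m P - 1, fold_wall m P + 1}"
    and "\<not> (0 < fold_wall m P \<and> fold_wall m P < 2 * int m) \<Longrightarrow> fold_wall m (P - 1) = fold_wall m (P + 1)"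
proof -
  define r where "r = P mod (4 * int m)"
  let ?M = "4 * int m" and ?r = "r"
  have r: "0 \<le> ?r" "?r < ?M" using assms unfolding r_def by auto
  have a: "(P + 1) mod ?M = (if ?r + 1 = ?M then 0 else ?r + 1)"
  proof (cases "?r + 1 = ?M")
    case True
    have "(P + 1) mod ?M = (?r + 1) mod ?M" by (simp add: r_def mod_add_left_eq)
    then show ?thesis using True by simp
  next
    case False
    have "(P + 1) mod ?M = (?r + 1) mod ?M" by (simp add: r_def mod_add_left_eq)
    also have "\<dots> = ?r + 1" using False r by (intro mod_pos_pos_trivial) auto
    finally show ?thesis using False by simp
  qed
  have b: "(P - 1) mod ?M = (if ?r = 0 then ?M - 1 else ?r - 1)"
  proof (cases "?r = 0")
    case True
    have "(P - 1) mod ?M = (?r - 1) mod ?M" by (simp add: r_def mod_diff_left_eq)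
    also have "\<dots> = (?M - 1) mod ?M" using True mod_diff_left_eq[of ?M ?M 1] by simp
    also have "\<dots> = ?M - 1" using assms by (intro mod_pos_pos_trivial) auto
    finally show ?thesis using True by simp
  next
    case False
    have "(P - 1) mod ?M = (?r - 1) mod ?M" by (simp add: r_def mod_diff_left_eq)
    also have "\<dots> = ?r - 1" using False r by (intro mod_pos_pos_trivial) auto
    finally show ?thesis using False by simp
  qed
  show "{fold_wall m (P - 1), fold_wall m (P + 1)} = {fold_wall m P - 1, fold_wall m P + 1}"
    if "0 < fold_wall m P \<and> fold_wall m P < 2 * int m"
    using that r unfolding fold_wall_def Let_def a b r_def[symmetric] by (auto split: if_splits)
  show "fold_wall m (P - 1) = fold_wall m (P + 1)"
    if "\<not> (0 < fold_wall m P \<and> fold_wall m P < 2 * int m)"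
    using that r assms unfolding fold_wall_def Let_def a b r_def[symmetric] by (auto split: if_splits)
qed


section \<open>Waves reflected at the walls of a box\<close>

lemma int_period:
  fixes f :: "int \<Rightarrow> bool"
  assumes "\<And>x. even x \<Longrightarrow> f (x + p) = f x" "even p" "even x"
  shows "f (x + p * k) = f x"
proof (induction k rule: int_induct[where k = 0])
  case (step1 i)
  then show ?case using assms(1)[of "x + p * i"] assms(2,3) by (simp add: algebra_simps)
next
  case (step2 i)
  then show ?case using assms(1)[of "x + p * (i - 1)"] assms(2,3) by (simp add: algebra_simps)
qed simp

text \<open>The relevant values sit where \<open>P + Q\<close> is odd, at edge midpoints; the
  equation sits where \<open>P + Q\<close> is even, at vertices and cell centres.\<close>

locale reflected_wave =
  fixes m n :: nat and F :: "int \<Rightarrow> int \<Rightarrow> bool"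
  assumes wave: "even (P + Q) \<Longrightarrow> (F (P - 1) Q \<noteq> F (P + 1) Q) = (F P (Q - 1) \<noteq> F P (Q + 1))"
    and even1: "F (- P) Q = F P Q" and even2: "F P (- Q) = F P Q"
    and period1: "F (P + 4 * int m) Q = F P Q"
    and wall1: "odd Q \<Longrightarrow> \<not> F 0 Q" "odd Q \<Longrightarrow> \<not> F (2 * int m) Q"
    and wall2: "odd P \<Longrightarrow> \<not> F P 0" "odd P \<Longrightarrow> \<not> F P (2 * int n)"
begin

text \<open>The row next to the wall \<open>Q = 0\<close>. As \<open>F\<close> vanishes on that
  wall, this row is the complete initial data of the wave.\<close>

definition g :: "int \<Rightarrow> bool" where "g R = F R 1"

text \<open>The wave equation says that this quantity is constant along diagonals.\<close>

lemma diagonal: "even (P + Q) \<Longrightarrow> (F (P + 1) Q \<noteq> F P (Q + 1)) = g (P - Q)"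
proof -
  \<comment> \<open>Inequality of truth values is addition modulo 2, so terms of the wave equation
    may change sides. The right-hand side is the same quantity one diagonal step earlier.\<close>
  have step: "(F (P + 1) Q \<noteq> F P (Q + 1)) = (F P (Q - 1) \<noteq> F (P - 1) Q)" if "even (P + Q)" for P Q
    using wave[OF that] by blast
  have zero: "(F (P + 1) 0 \<noteq> F P (0 + 1)) = g (P - 0)" if "even P" for P
    using wall2(1)[of "P + 1"] that by (simp add: g_def)
  show ?thesis if "even (P + Q)"
    using that
  proof (induction Q arbitrary: P rule: int_induct[where k = 0])
    case base
    then show ?case using zero[of P] by simp
  next
    case (step1 i)
    have eq: "P - 1 - i = P - (i + 1)" by simp
    show ?case using step1 step1.IH[of "P - 1"] step[of P "i + 1"] by (simp add: eq)
  next
    case (step2 i)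
    have eq: "P + 1 - i = P - (i - 1)" by simp
    show ?case using step2 step2.IH[of "P + 1"] step[of "P + 1" i] by (auto simp: eq)
  qed
qed

lemma g_minus: "g (- R) = g R"
  by (simp add: g_def even1)

lemma g_wall: "\<not> g 0" "\<not> g (2 * int m)" "\<not> g (2 * int n)"
proof -
  show "\<not> g 0" "\<not> g (2 * int m)" using wall1[of 1] by (simp_all add: g_def)
  \<comment> \<open>At this corner of the reflected box both values on the left lie on walls, and
    the diagonal leads to \<open>g (2 * int n)\<close>.\<close>
  have "(F (0 + 1) (- 2 * int n) \<noteq> F 0 (- 2 * int n + 1)) = g (0 - (- 2 * int n))"
    by (rule diagonal) simp
  then show "\<not> g (2 * int n)" using wall1(1) wall2(2)[of 1] even2[of 1 "2 * int n"] by simp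
qed

lemma g_period1: "g (R + 4 * int m) = g R"
  by (simp add: g_def period1)

text \<open>The wave arriving at the wall \<open>2 * n\<close> along the two diagonal directions is the same.\<close>

lemma g_period2:
  assumes "even R" shows "g (R + 4 * int n) = g R"
proof -
  define P where "P = R + 2 * int n"
  have P: "even P" using assms by (simp add: P_def)
  have "(F (P + 1) (2 * int n) \<noteq> F P (2 * int n + 1)) = g (P - 2 * int n)"
    using P by (intro diagonal) simp
  moreover have "(F (- P + 1) (2 * int n) \<noteq> F (- P) (2 * int n + 1)) = g (- P - 2 * int n)"
    using P by (intro diagonal) simp
  moreover have "\<not> F (P + 1) (2 * int n)" "\<not> F (- P + 1) (2 * int n)"
    using P by (simp_all add: wall2(2))
  ultimately have "g (P - 2 * int n) = g (- P - 2 * int n)" using even1 by simp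
  also have "\<dots> = g (P + 2 * int n)" using g_minus[of "P + 2 * int n"] by simp
  finally show ?thesis by (simp add: P_def algebra_simps)
qed

lemma g_period_gcd:
  assumes "even R" shows "g (R + 4 * int (gcd m n) * k) = g R"
proof -
  obtain u v where uv: "u * int m + v * int n = gcd (int m) (int n)"
    using bezout_int by blast
  have d: "int (gcd m n) = u * int m + v * int n" using uv by simp
  have "g (R + 4 * int (gcd m n) * k) = g ((R + (4 * int m) * (u * k)) + (4 * int n) * (v * k))"
    unfolding d by (simp add: algebra_simps)
  also have "\<dots> = g (R + (4 * int m) * (u * k))"
    by (rule int_period[of _ "4 * int n"]) (use assms g_period2 in simp_all)
  also have "\<dots> = g R"
    by (rule int_period[of _ "4 * int m"]) (use assms g_period1 in simp_all)
  finally show ?thesis .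
qed

text \<open>Here \<open>g\<close> has period 4 on even arguments, so only \<open>g 0\<close> and
  \<open>g 2\<close> matter. The first vanishes by the wall at 0, the second by the wall at
  \<open>2 * l\<close> for an odd side \<open>l\<close>. Then \<open>F\<close> vanishes row by
  row.\<close>

lemma trivial_if_coprime:
  assumes "gcd m n = 1" "odd (P + int Q)" shows "\<not> F P (int Q)"
proof -
  have "\<not> g R" if "even R" for R
  proof -
    have "odd m \<or> odd n" using assms(1) by (metis gcd_greatest even_numeral odd_one)
    then obtain l where "\<not> g (2 * int l)" "odd l" using g_wall by blast
    moreover from \<open>odd l\<close> obtain t where "l = 2 * t + 1" by (rule oddE)
    ultimately have "\<not> g 2" using g_period_gcd[of 2 "int t"] assms(1) by (simp add: algebra_simps)
    moreover have "\<exists>t. R = 4 * t \<or> R = 2 + 4 * t" using that by presburger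
    then obtain t where "R = 4 * t \<or> R = 2 + 4 * t" ..
    ultimately show ?thesis
      using g_period_gcd[of 0 t] g_period_gcd[of 2 t] g_wall(1) assms(1) by auto
  qed
  then show ?thesis using assms(2)
  proof (induction Q arbitrary: P)
    case 0
    then show ?case using wall2(1)[of P] by simp
  next
    case (Suc Q)
    then show ?case using diagonal[of P "int Q"] Suc.IH[of "P + 1"] by (simp add: add.commute)
  qed
qed

text \<open>Here \<open>g\<close> has period 8 on even arguments. It vanishes at 0 and, by the wall
  of a side not divisible by 4, at 4; evenness gives \<open>g 6 = g 2\<close>. One free bit remains,
  and summing along diagonals yields the block pattern.\<close>

lemma blocks_if_gcd_2:
  assumes "gcd m n = 2" "odd (P + int Q)"
  shows "F P (int Q) \<longleftrightarrow> g 2 \<and> (if even P then odd (P div 2) else odd (Q div 2))"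
proof -
  have g: "g R \<longleftrightarrow> g 2 \<and> R mod 4 = 2" if "even R" for R
  proof -
    have "\<not> (4 dvd m \<and> 4 dvd n)" using assms(1) by (metis gcd_greatest numeral_le_iff dvd_imp_le zero_less_numeral semiring_norm(69,71))
    moreover have "even m" "even n" using assms(1) by (metis gcd_dvd1, metis gcd_dvd2)
    ultimately obtain l where l: "\<not> g (2 * int l)" "even l" "\<not> 4 dvd l" using g_wall by blast
    then have "\<exists>t. l = 4 * t + 2" by presburger
    then obtain t where "l = 4 * t + 2" ..
    then have g4: "\<not> g 4" using l(1) g_period_gcd[of 4 "int t"] assms(1) by (simp add: algebra_simps)
    have g6: "g 6 = g 2" using g_period_gcd[of "-2" 1] g_minus[of 2] assms(1) by simp
    have "\<exists>t. R = 8 * t \<or> R = 2 + 8 * t \<or> R = 4 + 8 * t \<or> R = 6 + 8 * t" using that by presburger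
    then obtain t where "R = 8 * t \<or> R = 2 + 8 * t \<or> R = 4 + 8 * t \<or> R = 6 + 8 * t" ..
    moreover have "(8 * t) mod 4 = 0" "(2 + 8 * t) mod 4 = 2" "(4 + 8 * t) mod 4 = 0" "(6 + 8 * t) mod 4 = 2"
      by presburger+
    ultimately show ?thesis
      using g_period_gcd[of 0 t] g_period_gcd[of 2 t] g_period_gcd[of 4 t] g_period_gcd[of 6 t]
        g_wall(1) g4 g6 assms(1) by (elim disjE) simp_all
  qed
  show ?thesis using assms(2)
  proof (induction Q arbitrary: P)
    case 0
    then show ?case using wall2(1)[of P] by simp
  next
    case (Suc Q)
    then have e: "even (P + int Q)" by simp
    have "F P (int (Suc Q)) \<longleftrightarrow> (F (P + 1) (int Q) \<noteq> g (P - int Q))"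
      using diagonal[OF e] by (auto simp: add.commute)
    also have "F (P + 1) (int Q) \<longleftrightarrow> g 2 \<and> (if even (P + 1) then odd ((P + 1) div 2) else odd (Q div 2))"
      using e by (intro Suc.IH) simp
    also have "g (P - int Q) \<longleftrightarrow> g 2 \<and> (P - int Q) mod 4 = 2"
      using e by (intro g) simp
    finally have *: "F P (int (Suc Q)) \<longleftrightarrow> g 2 \<and> ((if even (P + 1) then odd ((P + 1) div 2) else odd (Q div 2))
        \<noteq> ((P - int Q) mod 4 = 2))" by blast
    have "((if even (P + 1) then odd ((P + 1) div 2) else odd (Q div 2)) \<noteq> ((P - int Q) mod 4 = 2)) \<longleftrightarrow>
        (if even P then odd (P div 2) else odd (Suc Q div 2))"
      using e by (cases "even P") (simp_all, presburger+)
    then show ?case unfolding * by simp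
  qed
qed

end

section \<open>The symmetric difference of two cycles with the same signature\<close>

text \<open>
  Edges as points of the medial lattice: the midpoint of an edge, doubled and shifted so that
  the grid occupies the box from \<open>0\<close> to \<open>2 * m\<close> and from \<open>0\<close> to \<open>2 * n\<close>.
\<close>

definition medial_edge :: "int \<Rightarrow> int \<Rightarrow> (nat \<times> nat) set" where
  "medial_edge p q = (if even p then hedge (nat p div 2) (nat (q + 1) div 2)
     else vedge (nat (p + 1) div 2) (nat q div 2))"

lemma medial_edge_h: "even p \<Longrightarrow> p = 2 * int x \<Longrightarrow> q = 2 * int y - 1 \<Longrightarrow> medial_edge p q = hedge x y"
  by (simp add: medial_edge_def nat_mult_distrib)

lemma medial_edge_v: "p = 2 * int x - 1 \<Longrightarrow> q = 2 * int y \<Longrightarrow> medial_edge p q = vedge x y"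
  by (simp add: medial_edge_def nat_mult_distrib)

locale signature_twins =
  fixes m n :: nat and C C' :: "(nat \<times> nat) set set"
  assumes mn: "m > 0" "n > 0"
    and cyc: "is_cycle (grid_edges m n) C" and cyc': "is_cycle (grid_edges m n) C'"
    and sig: "signature m n C = signature m n C'"
begin

lemmas sub = is_cycle_subset[OF cyc] and sub' = is_cycle_subset[OF cyc']

definition diff :: "(nat \<times> nat) set \<Rightarrow> bool" where
  "diff e \<longleftrightarrow> (e \<in> C) \<noteq> (e \<in> C')"

text \<open>Equal counts have equal parity, so the four differences sum to zero modulo 2. At a
  vertex the same follows from both degrees being even.\<close>

lemma diff_cell:
  assumes "1 \<le> x" "x < m" "1 \<le> y" "y < n"
  shows "(diff (hedge x y) \<noteq> diff (hedge x (y + 1))) = (diff (vedge x y) \<noteq> diff (vedge (x + 1) y))"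
proof -
  have "cell_count C x y = cell_count C' x y"
    using sig assms unfolding signature_eq_iff by simp
  then show ?thesis unfolding cell_count_def diff_def by (auto split: if_splits simp: of_bool_def)
qed

lemma diff_vertex:
  assumes "1 \<le> x" "1 \<le> y"
  shows "(diff (hedge (x - 1) y) \<noteq> diff (hedge x y)) = (diff (vedge x (y - 1)) \<noteq> diff (vedge x y))"
proof -
  have "even (vertex_count C x y)" "even (vertex_count C' x y)"
    using vertex_count_cycle[OF cyc assms] vertex_count_cycle[OF cyc' assms] by simp_all
  then show ?thesis unfolding vertex_count_def diff_def by (auto split: if_splits simp: of_bool_def)
qed

lemma diff_hedge_out: "\<not> (1 \<le> x \<and> x < m \<and> 1 \<le> y \<and> y \<le> n) \<Longrightarrow> \<not> diff (hedge x y)"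
  using hedge_bounds[OF sub, of x y] hedge_bounds[OF sub', of x y] unfolding diff_def by blast

lemma diff_vedge_out: "\<not> (1 \<le> x \<and> x \<le> m \<and> 1 \<le> y \<and> y < n) \<Longrightarrow> \<not> diff (vedge x y)"
  using vedge_bounds[OF sub, of x y] vedge_bounds[OF sub', of x y] unfolding diff_def by blast

definition f :: "int \<Rightarrow> int \<Rightarrow> bool" where
  "f p q = diff (medial_edge p q)"

text \<open>The walls carry segments that would stick out of the grid, such as
  \<open>hedge 0 y\<close> and \<open>hedge m y\<close>.\<close>

lemma f_wall: "odd q \<Longrightarrow> \<not> f 0 q" "odd q \<Longrightarrow> \<not> f (2 * int m) q" "odd p \<Longrightarrow> \<not> f p 0" "odd p \<Longrightarrow> \<not> f p (2 * int n)"
  unfolding f_def medial_edge_def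
  by (simp_all add: diff_hedge_out diff_vedge_out nat_mult_distrib)

text \<open>Points with two even coordinates are cell centres, points with two odd coordinates are
  vertices.\<close>

lemma f_wave:
  assumes "even (p + q)" "0 < p" "p < 2 * int m" "0 < q" "q < 2 * int n"
  shows "(f (p - 1) q \<noteq> f (p + 1) q) = (f p (q - 1) \<noteq> f p (q + 1))"
proof (cases "even p")
  case True
  then have "even q" using assms(1) by simp
  with True have "p = 2 * (p div 2)" "q = 2 * (q div 2)" by simp_all
  then have "p = 2 * int (nat (p div 2))" "q = 2 * int (nat (q div 2))" using assms by linarith+
  then obtain x y where xy: "p = 2 * int x" "q = 2 * int y" by blast
  have "medial_edge (p - 1) q = vedge x y" "medial_edge (p + 1) q = vedge (x + 1) y"
    by (rule medial_edge_v; simp add: xy)+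
  moreover have "medial_edge p (q - 1) = hedge x y" "medial_edge p (q + 1) = hedge x (y + 1)"
    by (rule medial_edge_h; simp add: xy)+
  moreover have "1 \<le> x" "x < m" "1 \<le> y" "y < n" using assms xy by auto
  ultimately show ?thesis using diff_cell[of x y] unfolding f_def by auto
next
  case False
  then have "odd q" using assms(1) by simp
  with False have "p = 2 * ((p + 1) div 2) - 1" "q = 2 * ((q + 1) div 2) - 1" by presburger+
  then have "p = 2 * int (nat ((p + 1) div 2)) - 1" "q = 2 * int (nat ((q + 1) div 2)) - 1"
    using assms by linarith+
  then obtain x y where xy: "p = 2 * int x - 1" "q = 2 * int y - 1" by blast
  have b: "1 \<le> x" "1 \<le> y" using assms xy by auto
  have "medial_edge (p - 1) q = hedge (x - 1) y" "medial_edge (p + 1) q = hedge x y"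
    by (rule medial_edge_h; use b in \<open>simp add: xy of_nat_diff\<close>)+
  moreover have "medial_edge p (q - 1) = vedge x (y - 1)" "medial_edge p (q + 1) = vedge x y"
    by (rule medial_edge_v; use b in \<open>simp add: xy of_nat_diff\<close>)+
  ultimately show ?thesis using diff_vertex[of x y] b unfolding f_def by auto
qed

sublocale reflected_wave m n "\<lambda>P Q. f (fold_wall m P) (fold_wall n Q)"
proof
  fix P Q :: int
  define p q where "p = fold_wall m P" "q = fold_wall n Q"
  have b: "0 \<le> p" "p \<le> 2 * int m" "0 \<le> q" "q \<le> 2 * int n"
    unfolding p_q_def using fold_wall_bounds mn by auto
  have par: "even p \<longleftrightarrow> even P" "even q \<longleftrightarrow> even Q" unfolding p_q_def by (rule even_fold_wall)+
  show "(f (fold_wall m (P - 1)) (fold_wall n Q) \<noteq> f (fold_wall m (P + 1)) (fold_wall n Q)) =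
      (f (fold_wall m P) (fold_wall n (Q - 1)) \<noteq> f (fold_wall m P) (fold_wall n (Q + 1)))"
    if "even (P + Q)"
  proof -
    have pq: "even (p + q)" using that par by simp
    have X: "(f (fold_wall m (P - 1)) q \<noteq> f (fold_wall m (P + 1)) q) =
      (if 0 < p \<and> p < 2 * int m then f (p - 1) q \<noteq> f (p + 1) q else False)"
      using fold_wall_neighbours[OF mn(1), of P] unfolding p_q_def doubleton_eq_iff by auto
    have Y: "(f p (fold_wall n (Q - 1)) \<noteq> f p (fold_wall n (Q + 1))) =
      (if 0 < q \<and> q < 2 * int n then f p (q - 1) \<noteq> f p (q + 1) else False)"
      using fold_wall_neighbours[OF mn(2), of Q] unfolding p_q_def doubleton_eq_iff by auto
    consider "0 < p" "p < 2 * int m" "0 < q" "q < 2 * int n" | "p = 0 \<or> p = 2 * int m" | "q = 0 \<or> q = 2 * int n"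
      using b by linarith
    then have "(f (fold_wall m (P - 1)) q \<noteq> f (fold_wall m (P + 1)) q) =
      (f p (fold_wall n (Q - 1)) \<noteq> f p (fold_wall n (Q + 1)))"
    proof cases
      case 1 then show ?thesis unfolding X Y using f_wave[OF pq] by simp
    next
      \<comment> \<open>On a wall both sides of the equation are false: across it the neighbours
        fold together, and along it \<open>f\<close> vanishes.\<close>
      case 2
      then have "even q" using pq by auto
      then have "\<not> f p (q - 1)" "\<not> f p (q + 1)" using 2 f_wall(1,2)[of "q - 1"] f_wall(1,2)[of "q + 1"] by auto
      then show ?thesis unfolding X Y using 2 by auto
    next
      case 3
      then have "even p" using pq by auto
      then have "\<not> f (p - 1) q" "\<not> f (p + 1) q" using 3 f_wall(3,4)[of "p - 1"] f_wall(3,4)[of "p + 1"] by auto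
      then show ?thesis unfolding X Y using 3 by auto
    qed
    then show ?thesis unfolding p_q_def .
  qed
  show "f (fold_wall m (- P)) (fold_wall n Q) = f (fold_wall m P) (fold_wall n Q)"
    "f (fold_wall m P) (fold_wall n (- Q)) = f (fold_wall m P) (fold_wall n Q)"
    using mn by (simp_all add: fold_wall_minus)
  show "f (fold_wall m (P + 4 * int m)) (fold_wall n Q) = f (fold_wall m P) (fold_wall n Q)"
    by (simp add: fold_wall_period)
  show "\<not> f (fold_wall m 0) (fold_wall n Q)" "\<not> f (fold_wall m (2 * int m)) (fold_wall n Q)" if "odd Q"
    using that mn f_wall(1,2)[of q] par(2) unfolding p_q_def by (simp_all add: fold_wall_id)
  show "\<not> f (fold_wall m P) (fold_wall n 0)" "\<not> f (fold_wall m P) (fold_wall n (2 * int n))" if "odd P"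
    using that mn f_wall(3,4)[of p] par(1) unfolding p_q_def by (simp_all add: fold_wall_id)
qed

lemma hedge_diff_iff:
  assumes "1 \<le> x" "x < m" "1 \<le> y" "y \<le> n"
  shows "diff (hedge x y) = f (fold_wall m (2 * int x)) (fold_wall n (int (2 * y - 1)))"
proof -
  have "int (2 * y - 1) = 2 * int y - 1" using assms by (simp add: of_nat_diff)
  then show ?thesis unfolding f_def
    using assms mn medial_edge_h[of "2 * int x" x "2 * int y - 1" y] by (simp add: fold_wall_id)
qed

lemma vedge_diff_iff:
  assumes "1 \<le> x" "x \<le> m" "1 \<le> y" "y < n"
  shows "diff (vedge x y) = f (fold_wall m (2 * int x - 1)) (fold_wall n (int (2 * y)))"
  unfolding f_def using assms mn medial_edge_v[of "2 * int x - 1" x "2 * int y" y] by (simp add: fold_wall_id)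

lemma eq_if_no_diff:
  assumes "\<And>x y. 1 \<le> x \<Longrightarrow> x < m \<Longrightarrow> 1 \<le> y \<Longrightarrow> y \<le> n \<Longrightarrow> \<not> diff (hedge x y)"
    and "\<And>x y. 1 \<le> x \<Longrightarrow> x \<le> m \<Longrightarrow> 1 \<le> y \<Longrightarrow> y < n \<Longrightarrow> \<not> diff (vedge x y)"
  shows "C = C'"
proof (rule grid_edge_set_eqI[OF sub sub'])
  show "hedge x y \<in> C \<longleftrightarrow> hedge x y \<in> C'" for x y
    using assms(1)[of x y] diff_hedge_out[of x y] unfolding diff_def by blast
  show "vedge x y \<in> C \<longleftrightarrow> vedge x y \<in> C'" for x y
    using assms(2)[of x y] diff_vedge_out[of x y] unfolding diff_def by blast
qed

lemma eq_if_coprime: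
  assumes "gcd m n = 1" shows "C = C'"
proof (rule eq_if_no_diff)
  show "\<not> diff (hedge x y)" if "1 \<le> x" "x < m" "1 \<le> y" "y \<le> n" for x y
    unfolding hedge_diff_iff[OF that] using that by (intro trivial_if_coprime assms) simp
  show "\<not> diff (vedge x y)" if "1 \<le> x" "x \<le> m" "1 \<le> y" "y < n" for x y
    unfolding vedge_diff_iff[OF that] by (intro trivial_if_coprime assms) simp
qed

text \<open>The free bit \<open>g 2\<close> must be set, for otherwise no edge would differ.\<close>

lemma diff_blocks_if_gcd_2:
  assumes "gcd m n = 2" "C \<noteq> C'"
  shows "1 \<le> x \<Longrightarrow> x < m \<Longrightarrow> 1 \<le> y \<Longrightarrow> y \<le> n \<Longrightarrow> diff (hedge x y) \<longleftrightarrow> odd x"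
    and "1 \<le> x \<Longrightarrow> x \<le> m \<Longrightarrow> 1 \<le> y \<Longrightarrow> y < n \<Longrightarrow> diff (vedge x y) \<longleftrightarrow> odd y"
proof -
  have h: "diff (hedge x y) \<longleftrightarrow> g 2 \<and> odd x" if "1 \<le> x" "x < m" "1 \<le> y" "y \<le> n" for x y
    unfolding hedge_diff_iff[OF that] using that blocks_if_gcd_2[OF assms(1), of "2 * int x" "2 * y - 1"] by simp
  have v: "diff (vedge x y) \<longleftrightarrow> g 2 \<and> odd y" if "1 \<le> x" "x \<le> m" "1 \<le> y" "y < n" for x y
    unfolding vedge_diff_iff[OF that] using blocks_if_gcd_2[OF assms(1), of "2 * int x - 1" "2 * y"] by simp
  have "g 2" using eq_if_no_diff assms(2) h v by blast
  then show "1 \<le> x \<Longrightarrow> x < m \<Longrightarrow> 1 \<le> y \<Longrightarrow> y \<le> n \<Longrightarrow> diff (hedge x y) \<longleftrightarrow> odd x"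
    and "1 \<le> x \<Longrightarrow> x \<le> m \<Longrightarrow> 1 \<le> y \<Longrightarrow> y < n \<Longrightarrow> diff (vedge x y) \<longleftrightarrow> odd y"
    using h v by simp_all
qed

end

section \<open>Orientation of grid cycles\<close>

text \<open>Parity of the number of edges of \<open>C\<close> met by the horizontal ray to the left of a cell.\<close>

primrec inside :: "(nat \<times> nat) set set \<Rightarrow> nat \<Rightarrow> nat \<Rightarrow> bool" where
  "inside C 0 y = False"
| "inside C (Suc x) y = (inside C x y \<noteq> (vedge (Suc x) y \<in> C))"

text \<open>A discrete Jordan curve argument: walking to the right, the even degree of each vertex
  carries the claim from one horizontal segment to the next.\<close>

lemma inside_below:
  assumes "is_cycle (grid_edges m n) C"
  shows "hedge x (Suc y) \<in> C \<longleftrightarrow> inside C x (Suc y) \<noteq> inside C x y"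
proof (induction x)
  case 0
  then show ?case using hedge_bounds[OF is_cycle_subset[OF assms], of 0 "Suc y"] by auto
next
  case (Suc x)
  have "even (vertex_count C (Suc x) (Suc y))"
    using vertex_count_cycle[OF assms, of "Suc x" "Suc y"] by simp
  then have "((hedge x (Suc y) \<in> C) \<noteq> (hedge (Suc x) (Suc y) \<in> C)) =
      ((vedge (Suc x) y \<in> C) \<noteq> (vedge (Suc x) (Suc y) \<in> C))"
    unfolding vertex_count_def by (auto simp: of_bool_def split: if_splits)
  then show ?case using Suc by auto
qed

text \<open>The orientation of the edges of \<open>C\<close> that keeps the inside on the left.\<close>

definition oriented :: "(nat \<times> nat) set set \<Rightarrow> nat \<times> nat \<Rightarrow> nat \<times> nat \<Rightarrow> bool" where
  "oriented C u w \<longleftrightarrow> (\<exists>x y.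
     u = (x, y) \<and> w = (x + 1, y) \<and> hedge x y \<in> C \<and> inside C x y \<or>
     u = (x + 1, y) \<and> w = (x, y) \<and> hedge x y \<in> C \<and> inside C x (y - 1) \<or>
     u = (x, y) \<and> w = (x, y + 1) \<and> vedge x y \<in> C \<and> inside C (x - 1) y \<or>
     u = (x, y + 1) \<and> w = (x, y) \<and> vedge x y \<in> C \<and> inside C x y)"

lemma oriented_unit:
  "oriented C (x, y) (Suc x, y) \<longleftrightarrow> hedge x y \<in> C \<and> inside C x y"
  "oriented C (Suc x, y) (x, y) \<longleftrightarrow> hedge x y \<in> C \<and> inside C x (y - 1)"
  "oriented C (x, y) (x, Suc y) \<longleftrightarrow> vedge x y \<in> C \<and> inside C (x - 1) y"
  "oriented C (x, Suc y) (x, y) \<longleftrightarrow> vedge x y \<in> C \<and> inside C x y"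
  by (auto simp: oriented_def)

lemma oriented_edge: "oriented C u w \<Longrightarrow> {u, w} \<in> C"
  by (auto simp: oriented_def hedge_def vedge_def insert_commute)

text \<open>The two cells beside an edge of \<open>C\<close> lie on different sides of
  \<open>C\<close>, so only one direction has the inside on its left.\<close>

lemma oriented_flip:
  assumes "is_cycle (grid_edges m n) C" "{u, w} \<in> C"
  shows "oriented C u w \<longleftrightarrow> \<not> oriented C w u"
proof -
  note sub = is_cycle_subset[OF assms(1)]
  have "{u, w} \<in> grid_edges m n" using sub assms(2) by blast
  then show ?thesis
  proof (cases rule: grid_edges_cases)
    case (1 x y)
    then have h: "hedge x y \<in> C" using assms(2) by simp
    then have "y = Suc (y - 1)" using hedge_bounds[OF sub h] by simp
    then have "inside C x y \<noteq> inside C x (y - 1)"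
      using h inside_below[OF assms(1), of x "y - 1"] by simp
    then show ?thesis using 1 h by (auto simp: hedge_def doubleton_eq_iff oriented_unit)
  next
    case (2 x y)
    then have v: "vedge x y \<in> C" using assms(2) by simp
    then have "x = Suc (x - 1)" using vedge_bounds[OF sub v] by simp
    then have "inside C x y \<noteq> inside C (x - 1) y" using v inside.simps(2)[of C "x - 1" y] by simp
    then show ?thesis using 2 v by (auto simp: vedge_def doubleton_eq_iff oriented_unit)
  qed
qed

text \<open>The two edges at \<open>v\<close> separate the four surrounding cells into an inside and
  an outside sector; only one of these edges, when leaving \<open>v\<close>, has the inside on its
  left.\<close>

lemma oriented_unique:
  assumes "is_cycle (grid_edges m n) C" "v \<in> \<Union> C"
  shows "\<exists>!w. oriented C v w"
proof -
  have "v \<in> grid_vertices m n" using Union_grid_edges[OF is_cycle_subset[OF assms(1)]] assms(2) by blast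
  then have "1 \<le> fst v" "1 \<le> snd v" by (auto simp: grid_vertices_def)
  then obtain a b where v: "v = (Suc a, Suc b)" by (metis Suc_le_D One_nat_def prod.collapse)
  have o: "oriented C v w \<longleftrightarrow>
    w = (Suc (Suc a), Suc b) \<and> hedge (Suc a) (Suc b) \<in> C \<and> inside C (Suc a) (Suc b) \<or>
    w = (a, Suc b) \<and> hedge a (Suc b) \<in> C \<and> inside C a b \<or>
    w = (Suc a, Suc (Suc b)) \<and> vedge (Suc a) (Suc b) \<in> C \<and> inside C a (Suc b) \<or>
    w = (Suc a, b) \<and> vedge (Suc a) b \<in> C \<and> inside C (Suc a) b" (is "_ \<longleftrightarrow> ?R w") for w
  proof
    show "oriented C v w" if "?R w" using that unfolding v by (elim disjE) (simp_all add: oriented_unit)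
  qed (auto simp: oriented_def v)
  have "vertex_count C (Suc a) (Suc b) = 2"
    using vertex_count_cycle[OF assms(1), of "Suc a" "Suc b"] assms(2) v by simp
  \<comment> \<open>The two cells to the left of the vertex and its two vertical edges determine the
    other cells and edges, so sixteen cases suffice.\<close>
  then show ?thesis
    unfolding o vertex_count_def inside_below[OF assms(1)]
    by (cases "vedge (Suc a) (Suc b) \<in> C"; cases "vedge (Suc a) b \<in> C";
        cases "inside C a b"; cases "inside C a (Suc b)")
      (simp_all add: inside_below[OF assms(1)])
qed

section \<open>Signs of permutations and the successor permutation of a cycle\<close>

lemma sign_cycle_of_list: "distinct cs \<Longrightarrow> sign (cycle_of_list cs) = (- 1) ^ (length cs - 1)"
proof (induction cs rule: cycle_of_list.induct)
  case (1 i j cs)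
  have "sign (transpose i j \<circ> cycle_of_list (j # cs)) = sign (transpose i j) * sign (cycle_of_list (j # cs))"
    by (intro sign_compose permutation_swap_id permutation_of_cycle)
  then show ?case unfolding cycle_of_list.simps using 1 by (simp add: sign_swap_id del: comp_apply)
qed simp_all

lemma cycle_of_list_nth:
  assumes "distinct vs" "i < length vs"
  shows "cycle_of_list vs (vs ! i) = vs ! (Suc i mod length vs)"
proof -
  have "map (cycle_of_list vs) vs = rotate1 vs"
    using cyclic_rotation[OF assms(1), of 1] by simp
  then show ?thesis using assms(2) by (metis nth_map nth_rotate1)
qed

lemma grid_edge_parity:
  assumes "{u, w} \<in> grid_edges m n"
  shows "even (fst u + snd u) \<noteq> even (fst w + snd w)"
  using assms by (cases rule: grid_edges_cases) (auto simp: hedge_def vedge_def doubleton_eq_iff)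

text \<open>In a chessboard colouring of the vertices the colour alternates along the walk and must
  return to its initial value.\<close>

lemma even_length_grid_cycle:
  assumes "length vs \<ge> 3" "closed_walk_edges vs \<subseteq> grid_edges m n"
  shows "even (length vs)"
proof -
  define par where "par v = even (fst v + snd v)" for v :: "nat \<times> nat"
  have step: "par (vs ! i) \<noteq> par (vs ! (Suc i mod length vs))" if "i < length vs" for i
    using that assms(2) grid_edge_parity unfolding par_def closed_walk_edges_def by blast
  have "par (vs ! i) = (par (vs ! 0) = even i)" if "i < length vs" for i
    using that
  proof (induction i)
    case (Suc i)
    then show ?case using step[of i] by auto
  qed simp
  moreover have "Suc (length vs - 1) = length vs" using assms(1) by linarith
  then have l: "length vs - 1 < length vs" "Suc (length vs - 1) mod length vs = 0"
    by (linarith, simp only: mod_self)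
  ultimately have "odd (length vs - 1)" using step[OF l(1)] l by metis
  then show ?thesis using assms(1) by simp
qed

text \<open>The orientation is consistent along the cycle, so its successor map is one cycle of even
  length, an odd permutation.\<close>

lemma oriented_permutation:
  assumes C: "is_cycle (grid_edges m n) C"
  obtains \<sigma> where "\<sigma> permutes \<Union> C" "\<And>v. v \<in> \<Union> C \<Longrightarrow> oriented C v (\<sigma> v)" "sign \<sigma> = -1"
    "even (card (\<Union> C))"
proof -
  obtain us where us: "length us \<ge> 3" "distinct us" "closed_walk_edges us \<subseteq> grid_edges m n" "C = closed_walk_edges us"
    using C unfolding is_cycle_def by blast
  have edge: "{ws ! i, ws ! (Suc i mod length ws)} \<in> closed_walk_edges ws" if "i < length ws" for i and ws :: "(nat \<times> nat) list"
    using that unfolding closed_walk_edges_def by blast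
  \<comment> \<open>Reversing the list if necessary makes one edge agree with the orientation; the
    first edge reappears in the reversed list at index \<open>length us - 2\<close>.\<close>
  have "\<exists>vs i. length vs \<ge> 3 \<and> distinct vs \<and> C = closed_walk_edges vs \<and> i < length vs \<and>
      oriented C (vs ! i) (vs ! (Suc i mod length vs))"
  proof (cases "oriented C (us ! 0) (us ! (Suc 0 mod length us))")
    case True
    then show ?thesis using us by (intro exI[of _ us] exI[of _ 0]) auto
  next
    case False
    have "{us ! 0, us ! (Suc 0 mod length us)} \<in> C"
      unfolding us(4) by (rule edge) (use us(1) in linarith)
    then have "oriented C (us ! 1) (us ! 0)"
      using oriented_flip[OF C] False us(1) by auto
    moreover have "rev us ! (length us - 2) = us ! 1" "rev us ! (Suc (length us - 2) mod length us) = us ! 0"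
      using us(1) by (auto simp: rev_nth Suc_diff_Suc numeral_2_eq_2)
    ultimately show ?thesis using us
      by (intro exI[of _ "rev us"] exI[of _ "length us - 2"]) (auto simp: closed_walk_edges_rev)
  qed
  then obtain vs i0 where vs: "length vs \<ge> 3" "distinct vs" "C = closed_walk_edges vs"
    and i0: "i0 < length vs" "oriented C (vs ! i0) (vs ! (Suc i0 mod length vs))" by blast
  let ?l = "length vs"
  have U: "\<Union> C = set vs" unfolding vs(3) by (rule Union_closed_walk_edges)
  \<comment> \<open>A vertex has two neighbours and one outgoing edge. The edge from its predecessor
    is incoming, so the outgoing one leads to the next entry; having three vertices keeps these two
    neighbours apart.\<close>
  have step: "oriented C (vs ! (Suc i mod ?l)) (vs ! (Suc (Suc i) mod ?l))"
    if "i < ?l" "oriented C (vs ! i) (vs ! (Suc i mod ?l))" for i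
  proof -
    let ?v = "vs ! (Suc i mod ?l)" and ?w = "vs ! (Suc (Suc i) mod ?l)"
    have j: "Suc i mod ?l < ?l" by (intro mod_less_divisor) (use that(1) in linarith)
    have e: "{?v, ?w} \<in> C" using edge[OF j] unfolding vs(3) by (simp add: mod_Suc_eq)
    have e': "{vs ! i, ?v} \<in> C" using edge[OF that(1)] unfolding vs(3) .
    have vU: "?v \<in> \<Union> C" using e by blast
    have ne: "?w \<noteq> vs ! i"
    proof -
      have "Suc (Suc i) mod ?l \<noteq> i"
      proof (cases "Suc (Suc i) < ?l")
        case False
        then have "Suc (Suc i) mod ?l = Suc (Suc i) - ?l" using that(1) vs(1)
          by (simp add: mod_if)
        then show ?thesis using vs(1) False by linarith
      qed simp
      moreover have "Suc (Suc i) mod ?l < ?l" by (intro mod_less_divisor) (use that(1) in linarith)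
      ultimately show ?thesis using nth_eq_iff_index_eq[OF vs(2) _ that(1)] by blast
    qed
    obtain t where t: "oriented C ?v t" using oriented_unique[OF C vU] by blast
    have "t \<noteq> vs ! i" using t that(2) oriented_flip[OF C e'] by blast
    moreover obtain p q where pq: "\<And>z. {?v, z} \<in> C \<longleftrightarrow> z = p \<or> z = q"
      using cycle_neighbours[OF C vU] by metis
    moreover have "{?v, t} \<in> C" using oriented_edge[OF t] .
    moreover have "{?v, vs ! i} \<in> C" using e' by (simp add: insert_commute)
    ultimately have "t = ?w" using e ne by metis
    then show ?thesis using t by simp
  qed
  have all: "oriented C (vs ! ((i0 + k) mod ?l)) (vs ! (Suc (i0 + k) mod ?l))" for k
  proof (induction k)
    case 0
    then show ?case using i0 by simp
  next
    case (Suc k)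
    have "(i0 + k) mod ?l < ?l" by (intro mod_less_divisor) (use i0(1) in linarith)
    from step[OF this] Suc show ?case by (simp add: mod_Suc_eq) (metis mod_Suc_eq)
  qed
  have or: "oriented C (vs ! i) (vs ! (Suc i mod ?l))" if "i < ?l" for i
  proof -
    have "(i0 + (i + ?l - i0)) mod ?l = i" "Suc (i0 + (i + ?l - i0)) mod ?l = Suc i mod ?l"
      using that i0(1) by (simp_all, metis add_Suc mod_add_self2)
    then show ?thesis using all[of "i + ?l - i0"] by metis
  qed
  have "cycle_of_list vs permutes \<Union> C" unfolding U by (rule cycle_permutes)
  moreover have "oriented C v (cycle_of_list vs v)" if v: "v \<in> \<Union> C" for v
  proof -
    obtain i where "i < ?l" "v = vs ! i" using v unfolding U by (metis in_set_conv_nth)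
    then show ?thesis using or cycle_of_list_nth[OF vs(2)] by simp
  qed
  moreover have ev: "even ?l"
    using even_length_grid_cycle[of vs] vs is_cycle_subset[OF C] by blast
  then have "odd (?l - 1)" using vs(1) by presburger
  then have "sign (cycle_of_list vs) = -1"
    using sign_cycle_of_list[OF vs(2)] by simp
  moreover have "even (card (\<Union> C))" unfolding U using ev vs(2) by (simp add: distinct_card)
  ultimately show ?thesis using that by blast
qed

lemma sign_on_UN:
  assumes I: "finite I" and "\<And>i. i \<in> I \<Longrightarrow> finite (B i)" "\<And>i. i \<in> I \<Longrightarrow> bij_betw p (B i) (B i)"
    and "\<And>i j. i \<in> I \<Longrightarrow> j \<in> I \<Longrightarrow> i \<noteq> j \<Longrightarrow> B i \<inter> B j = {}"
  shows "sign_on (\<Union>i\<in>I. B i) p = (\<Prod>i\<in>I. sign_on (B i) p)"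
  using assms
proof (induction I rule: finite_induct)
  case (insert i I)
  let ?U = "\<Union>j\<in>I. B j"
  have bij: "bij_betw p (B i) (B i)" using insert.prems(2) by blast
  have "bij_betw p ?U ?U"
  proof (rule bij_betw_UNION_disjoint)
    show "disjoint_family_on B I" using insert.prems(3) unfolding disjoint_family_on_def by blast
  qed (use insert.prems(2) in blast)
  have fin: "finite (B i)" "finite ?U" using insert by auto
  have disj: "B i \<inter> ?U = {}" using insert by blast
  have "restrict_id p (B i \<union> ?U) = restrict_id p (B i) \<circ> restrict_id p ?U"
  proof
    fix v
    show "restrict_id p (B i \<union> ?U) v = (restrict_id p (B i) \<circ> restrict_id p ?U) v"
      using bij_betw_apply[OF \<open>bij_betw p ?U ?U\<close>, of v] disj unfolding restrict_id_def by auto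
  qed
  then have "sign_on (B i \<union> ?U) p = sign (restrict_id p (B i) \<circ> restrict_id p ?U)"
    unfolding sign_on_def by (rule arg_cong)
  also have "\<dots> = sign_on (B i) p * sign_on ?U p"
    unfolding sign_on_def
    by (intro sign_compose permutes_imp_permutation[OF fin(1) permutes_restrict_id[OF bij]]
      permutes_imp_permutation[OF fin(2) permutes_restrict_id[OF \<open>bij_betw p ?U ?U\<close>]])
  also have "sign_on ?U p = (\<Prod>i\<in>I. sign_on (B i) p)" using insert.IH insert.prems by blast
  finally show ?case using insert.hyps by simp
qed (simp add: sign_on_def restrict_id_def)

section \<open>Parity of the number of blocks\<close>

text \<open>The edges to \<open>b\<close> and \<open>d\<close> exhaust the degree of
  \<open>v\<close> in \<open>A'\<close>; by \<open>common\<close>, an edge of \<open>A\<close> at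
  \<open>v\<close> would be a third one.\<close>

lemma cycle_avoids_vertex:
  assumes A: "is_cycle E A" and A': "is_cycle E' A'"
    and common: "\<And>w. {v, w} \<in> A \<Longrightarrow> w \<noteq> b \<Longrightarrow> w \<noteq> d \<Longrightarrow> {v, w} \<in> A'"
    and bd: "{v, b} \<notin> A" "{v, d} \<notin> A" "{v, b} \<in> A'" "{v, d} \<in> A'" "b \<noteq> d"
  shows "v \<notin> \<Union> A"
proof
  assume v: "v \<in> \<Union> A"
  obtain u where "{v, u} \<in> A" using cycle_neighbours[OF A v] by metis
  moreover have "v \<in> \<Union> A'" using bd(3) by blast
  then obtain p q where "\<And>z. {v, z} \<in> A' \<longleftrightarrow> z = p \<or> z = q" using cycle_neighbours[OF A'] by metis
  ultimately show False using common bd by metis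
qed

locale block_twins = signature_twins +
  fixes \<sigma> \<sigma>' :: "nat \<times> nat \<Rightarrow> nat \<times> nat"
  assumes ev: "even m" "even n"
    and diff_hedge_in: "1 \<le> x \<Longrightarrow> x < m \<Longrightarrow> 1 \<le> y \<Longrightarrow> y \<le> n \<Longrightarrow> diff (hedge x y) \<longleftrightarrow> odd x"
    and diff_vedge_in: "1 \<le> x \<Longrightarrow> x \<le> m \<Longrightarrow> 1 \<le> y \<Longrightarrow> y < n \<Longrightarrow> diff (vedge x y) \<longleftrightarrow> odd y"
    and perm: "\<sigma> permutes \<Union> C" and perm': "\<sigma>' permutes \<Union> C'"
    and or: "v \<in> \<Union> C \<Longrightarrow> oriented C v (\<sigma> v)" and or': "v \<in> \<Union> C' \<Longrightarrow> oriented C' v (\<sigma>' v)"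
begin

lemma diff_hedge: "x \<le> m \<Longrightarrow> 1 \<le> y \<Longrightarrow> y \<le> n \<Longrightarrow> diff (hedge x y) \<longleftrightarrow> odd x"
  using diff_hedge_in[of x y] diff_hedge_out[of x y] ev(1)
  by (cases "x = 0 \<or> x = m") auto

lemma diff_vedge: "1 \<le> x \<Longrightarrow> x \<le> m \<Longrightarrow> y \<le> n \<Longrightarrow> diff (vedge x y) \<longleftrightarrow> odd y"
  using diff_vedge_in[of x y] diff_vedge_out[of x y] ev(2)
  by (cases "y = 0 \<or> y = n") auto

text \<open>In a row with odd \<open>y\<close> every vertical segment lies in exactly one cycle, so
  the two ray parities separate and meet again in turn. In all other rows they agree.\<close>

lemma inside_twin: "x \<le> m \<Longrightarrow> y \<le> n \<Longrightarrow> inside C' x y \<longleftrightarrow> inside C x y \<noteq> (odd x \<and> odd y)"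
proof (induction x)
  case (Suc x)
  then show ?case using diff_vedge[of "Suc x" y] unfolding diff_def by auto
qed simp

text \<open>Neither cell beside a common edge is a block, and outside the blocks the two insides
  agree.\<close>

lemma oriented_common:
  assumes "{u, w} \<in> C" "\<not> diff {u, w}"
  shows "oriented C u w = oriented C' u w"
proof -
  have "{u, w} \<in> grid_edges m n" using sub assms(1) by blast
  then show ?thesis
  proof (cases rule: grid_edges_cases)
    case (1 x y)
    then have h: "hedge x y \<in> C" "hedge x y \<in> C'" "\<not> diff (hedge x y)" using assms by (auto simp: diff_def)
    note b = hedge_bounds[OF sub h(1)]
    then have "even x" using h(3) diff_hedge[of x y] by simp
    then have "inside C' x y = inside C x y" "inside C' x (y - 1) = inside C x (y - 1)"
      using inside_twin[of x y] inside_twin[of x "y - 1"] b by auto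
    then show ?thesis using 1 h(1,2) by (auto simp: hedge_def doubleton_eq_iff oriented_unit)
  next
    case (2 x y)
    then have h: "vedge x y \<in> C" "vedge x y \<in> C'" "\<not> diff (vedge x y)" using assms by (auto simp: diff_def)
    note b = vedge_bounds[OF sub h(1)]
    then have "even y" using h(3) diff_vedge[of x y] by simp
    then have "inside C' x y = inside C x y" "inside C' (x - 1) y = inside C (x - 1) y"
      using inside_twin[of x y] inside_twin[of "x - 1" y] b by auto
    then show ?thesis using 2 h(1,2) by (auto simp: vedge_def doubleton_eq_iff oriented_unit)
  qed
qed

lemma sigma_eq: "oriented C v w \<Longrightarrow> \<sigma> v = w"
  using oriented_unique[OF cyc] or[of v] oriented_edge[of C v w] by blast

lemma sigma'_eq: "oriented C' v w \<Longrightarrow> \<sigma>' v = w"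
  using oriented_unique[OF cyc'] or'[of v] oriented_edge[of C' v w] by blast

definition \<pi> :: "nat \<times> nat \<Rightarrow> nat \<times> nat" where "\<pi> = \<sigma>' \<circ> inv \<sigma>"

lemma pi_sigma: "\<pi> (\<sigma> v) = \<sigma>' v"
  by (simp add: \<pi>_def permutes_inverses(2)[OF perm])

text \<open>\<open>b\<close> and \<open>d\<close> stand for the neighbours of \<open>v\<close> on
  its block; other edges at \<open>v\<close> lead to different blocks.\<close>

definition corner :: "nat \<times> nat \<Rightarrow> nat \<times> nat \<Rightarrow> nat \<times> nat \<Rightarrow> bool" where
  "corner v b d \<longleftrightarrow> (\<forall>w. {v, w} \<in> C \<union> C' \<longrightarrow> w \<noteq> b \<longrightarrow> w \<noteq> d \<longrightarrow> \<not> diff {v, w})"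

text \<open>A block is inside exactly one of the two cycles. So when its boundary is traversed along
  the edges of \<open>C\<close>, those of \<open>C'\<close> point backwards.\<close>

definition boundary_step :: "nat \<times> nat \<Rightarrow> nat \<times> nat \<Rightarrow> bool" where
  "boundary_step u w \<longleftrightarrow> diff {u, w} \<and> ({u, w} \<in> C \<longrightarrow> oriented C u w) \<and> ({u, w} \<notin> C \<longrightarrow> oriented C' w u)"

definition block :: "nat \<times> nat \<Rightarrow> nat \<times> nat \<Rightarrow> nat \<times> nat \<Rightarrow> nat \<times> nat \<Rightarrow> bool" where
  "block a b c d \<longleftrightarrow> distinct [a, b, c, d] \<and>
     boundary_step a b \<and> boundary_step b c \<and> boundary_step c d \<and> boundary_step d a \<and>
     corner a d b \<and> corner b a c \<and> corner c b d \<and> corner d c a"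

lemma block_rotate: "block a b c d \<Longrightarrow> block b c d a"
  unfolding block_def by auto

text \<open>\<open>C\<close> leaves \<open>v\<close> along the block, hence enters it along an edge
  between blocks. That edge is common and equally oriented, so \<open>v\<close> has the same
  predecessor in both cycles.\<close>

lemma pi_fixed:
  assumes "corner v b d" "oriented C v b" "{v, d} \<notin> C"
  shows "\<pi> v = v"
proof -
  have vb: "{v, b} \<in> C" using oriented_edge[OF assms(2)] .
  then have v: "v \<in> \<Union> C" by blast
  define w where "w = inv \<sigma> v"
  have s: "\<sigma> w = v" unfolding w_def using permutes_inverses(1)[OF perm] .
  then have "w \<in> \<Union> C" using v permutes_in_image[OF perm] by metis
  then have o: "oriented C w v" using or[of w] s by simp
  then have wv: "{w, v} \<in> C" by (rule oriented_edge)
  then have "{v, w} \<in> C" by (simp add: insert_commute)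
  moreover have "w \<noteq> d" using \<open>{v, w} \<in> C\<close> assms(3) by blast
  moreover have "w \<noteq> b" using o assms(2) oriented_flip[OF cyc vb] by blast
  ultimately have "\<not> diff {v, w}" using assms(1) unfolding corner_def by blast
  then have "\<not> diff {w, v}" by (simp add: insert_commute)
  then have "\<sigma>' w = v" using oriented_common[OF wv] o sigma'_eq by blast
  then show ?thesis using pi_sigma[of w] s by simp
qed

lemma corner_avoids:
  assumes "corner v b d" "diff {v, b}" "diff {v, d}" "b \<noteq> d"
  shows "{v, b} \<notin> C \<Longrightarrow> {v, d} \<notin> C \<Longrightarrow> v \<notin> \<Union> C"
    and "{v, b} \<in> C \<Longrightarrow> {v, d} \<in> C \<Longrightarrow> v \<notin> \<Union> C'"
proof -
  show "v \<notin> \<Union> C" if "{v, b} \<notin> C" "{v, d} \<notin> C"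
    using that assms unfolding corner_def diff_def
    by (intro cycle_avoids_vertex[OF cyc cyc', of v b d]) blast+
  show "v \<notin> \<Union> C'" if "{v, b} \<in> C" "{v, d} \<in> C"
    using that assms unfolding corner_def diff_def
    by (intro cycle_avoids_vertex[OF cyc' cyc, of v b d]) blast+
qed

text \<open>The alternatives are a 3-cycle, when the two edges of \<open>C\<close> on the block are
  adjacent and one corner is missed, and a transposition, when they are opposite.\<close>

definition block_signs :: "(nat \<times> nat) set \<Rightarrow> bool" where
  "block_signs B \<longleftrightarrow> bij_betw \<pi> B B \<and>
     (sign_on B \<pi> = 1 \<and> card (B \<inter> \<Union> C) = 3 \<or> sign_on B \<pi> = -1 \<and> card (B \<inter> \<Union> C) = 4)"

lemma block_signs_adjacent:
  assumes bl: "block a b c d" and C: "{a, b} \<in> C" "{b, c} \<in> C" "{c, d} \<notin> C" "{d, a} \<notin> C"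
  shows "block_signs {a, b, c, d}"
proof -
  let ?B = "{a, b, c, d}"
  have dist: "a \<noteq> b" "a \<noteq> c" "a \<noteq> d" "b \<noteq> c" "b \<noteq> d" "c \<noteq> d" using bl unfolding block_def by auto
  have s: "\<sigma> a = b" "\<sigma> b = c" "\<sigma>' d = c" "\<sigma>' a = d"
    using bl C sigma_eq sigma'_eq unfolding block_def boundary_step_def by blast+
  have d: "diff {a, b}" "diff {b, c}" "diff {c, d}" "diff {d, a}"
    using bl unfolding block_def boundary_step_def by blast+
  \<comment> \<open>Both block edges at \<open>d\<close> belong to \<open>C'\<close>, so
    \<open>C\<close> cannot pass through \<open>d\<close>; likewise \<open>C'\<close> cannot pass
    through \<open>b\<close>.\<close>
  have "d \<notin> \<Union> C" using corner_avoids(1)[of d c a] bl C d dist unfolding block_def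
    by (metis insert_commute)
  then have sd: "\<sigma> d = d" using perm by (simp add: permutes_not_in)
  have "b \<notin> \<Union> C'" using corner_avoids(2)[of b a c] bl C d dist unfolding block_def
    by (metis insert_commute)
  then have sb: "\<sigma>' b = b" using perm' by (simp add: permutes_not_in)
  have "oriented C a b" using bl C(1) unfolding block_def boundary_step_def by blast
  moreover have "corner a b d" using bl unfolding block_def corner_def by blast
  moreover have "{a, d} \<notin> C" using C(4) by (simp add: insert_commute)
  ultimately have "\<pi> a = a" by (intro pi_fixed[of a b d])
  then have pi: "\<pi> a = a" "\<pi> b = d" "\<pi> c = b" "\<pi> d = c"
    using pi_sigma[of a] pi_sigma[of b] pi_sigma[of d] s sd sb by simp_all
  have "bij_betw \<pi> ?B ?B" unfolding bij_betw_def inj_on_def using pi dist by auto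
  moreover have "sign_on ?B \<pi> = 1"
  proof -
    \<comment> \<open>The 3-cycle taking \<open>b\<close> to \<open>d\<close>, \<open>d\<close> to
      \<open>c\<close> and \<open>c\<close> to \<open>b\<close>, as a product of two
      transpositions.\<close>
    have "sign_on ?B \<pi> = sign_on ?B (transpose c d \<circ> transpose b c)"
      using pi dist by (intro sign_on_cong) (auto simp: transpose_def)
    also have "\<dots> = sign (transpose c d \<circ> transpose b c)"
      by (rule sign_on_permutes[of _ ?B]) (auto intro!: permutes_compose permutes_swap_id)
    also have "\<dots> = 1"
      using dist by (subst sign_compose) (auto simp: permutation_swap_id sign_swap_id)
    finally show ?thesis .
  qed
  moreover have "?B \<inter> \<Union> C = {a, b, c}" using \<open>d \<notin> \<Union> C\<close> C(1,2) by blast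
  then have "card (?B \<inter> \<Union> C) = 3" using dist by simp
  ultimately show ?thesis unfolding block_signs_def by blast
qed

lemma block_signs_opposite:
  assumes bl: "block a b c d" and C: "{a, b} \<in> C" "{b, c} \<notin> C" "{c, d} \<in> C" "{d, a} \<notin> C"
  shows "block_signs {a, b, c, d}"
proof -
  let ?B = "{a, b, c, d}"
  have dist: "a \<noteq> b" "a \<noteq> c" "a \<noteq> d" "b \<noteq> c" "b \<noteq> d" "c \<noteq> d" using bl unfolding block_def by auto
  have s: "\<sigma> a = b" "\<sigma> c = d" "\<sigma>' c = b" "\<sigma>' a = d"
    using bl C sigma_eq sigma'_eq unfolding block_def boundary_step_def by blast+
  have o: "oriented C a b" "oriented C c d" using bl C unfolding block_def boundary_step_def by blast+
  have k: "corner a b d" "corner c d b" using bl unfolding block_def corner_def by blast+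
  have "{a, d} \<notin> C" "{c, b} \<notin> C" using C by (simp_all add: insert_commute)
  then have "\<pi> a = a" "\<pi> c = c" using o k pi_fixed by blast+
  then have pi: "\<pi> a = a" "\<pi> b = d" "\<pi> c = c" "\<pi> d = b"
    using pi_sigma[of a] pi_sigma[of c] s by simp_all
  have "bij_betw \<pi> ?B ?B" unfolding bij_betw_def inj_on_def using pi dist by auto
  moreover have "sign_on ?B \<pi> = -1"
  proof -
    have "sign_on ?B \<pi> = sign_on ?B (transpose b d)"
      using pi dist by (intro sign_on_cong) (auto simp: transpose_def)
    also have "\<dots> = -1"
      using dist by (intro sign_on_transpose) auto
    finally show ?thesis .
  qed
  moreover have "?B \<inter> \<Union> C = {a, b, c, d}" using C(1,3) by blast
  then have "card (?B \<inter> \<Union> C) = 4" using dist by simp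
  ultimately show ?thesis unfolding block_signs_def by blast
qed

text \<open>Of the six choices of two sides, four are rotations of the adjacent case and two of the
  opposite case.\<close>

lemma block_signs:
  assumes bl: "block a b c d"
    and "of_bool ({a, b} \<in> C) + of_bool ({b, c} \<in> C) + of_bool ({c, d} \<in> C) + of_bool ({d, a} \<in> C) = (2 :: nat)"
  shows "block_signs {a, b, c, d}"
proof -
  have r: "{b, c, d, a} = {a, b, c, d}" "{c, d, a, b} = {a, b, c, d}" "{d, a, b, c} = {a, b, c, d}" by auto
  note b1 = block_rotate[OF bl] note b2 = block_rotate[OF b1] note b3 = block_rotate[OF b2]
  note adj = block_signs_adjacent[OF bl] block_signs_adjacent[OF b1, unfolded r]
    block_signs_adjacent[OF b2, unfolded r] block_signs_adjacent[OF b3, unfolded r]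
  note opp = block_signs_opposite[OF bl] block_signs_opposite[OF b1, unfolded r]
  show ?thesis
    using assms(2) adj opp
    by (cases "{a, b} \<in> C"; cases "{b, c} \<in> C"; cases "{c, d} \<in> C"; cases "{d, a} \<in> C") simp_all
qed

lemma grid_corner:
  assumes "1 \<le> x" "x \<le> m" "1 \<le> y" "y \<le> n"
  shows "corner (x, y) (if odd x then x + 1 else x - 1, y) (x, if odd y then y + 1 else y - 1)"
  unfolding corner_def
proof (intro allI impI)
  fix w
  assume "{(x, y), w} \<in> C \<union> C'" and w: "w \<noteq> (if odd x then x + 1 else x - 1, y)"
    "w \<noteq> (x, if odd y then y + 1 else y - 1)"
  then have "{(x, y), w} \<in> grid_edges m n" using sub sub' by blast
  from grid_edge_neighbour[OF this]
  consider "w = (x - 1, y)" "odd x" | "w = (x + 1, y)" "even x" | "w = (x, y - 1)" "odd y" | "w = (x, y + 1)" "even y"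
    using w by (cases "odd x"; cases "odd y") auto
  then show "\<not> diff {(x, y), w}"
  proof cases
    case 1
    then show ?thesis using diff_hedge[of "x - 1" y] assms vertex_edges(1)[of x y] by simp
  next
    case 2
    then show ?thesis using diff_hedge[of x y] assms vertex_edges(2)[of x y] by simp
  next
    case 3
    then show ?thesis using diff_vedge[of x "y - 1"] assms vertex_edges(3)[of x y] by simp
  next
    case 4
    then show ?thesis using diff_vedge[of x y] assms vertex_edges(4)[of x y] by simp
  qed
qed

text \<open>Each side of a block lies in exactly one of the cycles, so the two equal counts add up
  to 4.\<close>

lemma grid_block_count:
  assumes "odd x" "odd y" "x < m" "y < n"
  shows "cell_count C x y = 2"
proof -
  have xy: "1 \<le> x" "1 \<le> y" using assms(1,2) by (simp_all add: Suc_le_eq odd_pos)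
  have "diff (hedge x y)" "diff (hedge x (y + 1))" "diff (vedge x y)" "diff (vedge (x + 1) y)"
    using assms xy diff_hedge[of x] diff_vedge[of _ y] by simp_all
  moreover have "cell_count C x y = cell_count C' x y"
    using sig assms xy unfolding signature_eq_iff by simp
  ultimately show ?thesis unfolding cell_count_def diff_def by (auto simp: of_bool_def split: if_splits)
qed

lemma grid_block_signs:
  assumes xy: "odd x" "odd y" "x < m" "y < n"
  shows "block_signs {(x, y), (x + 1, y), (x + 1, y + 1), (x, y + 1)}"
proof -
  let ?a = "(x, y)" and ?b = "(x + 1, y)" and ?c = "(x + 1, y + 1)" and ?d = "(x, y + 1)"
  have pos: "1 \<le> x" "1 \<le> y" using xy(1,2) by (simp_all add: Suc_le_eq odd_pos)
  have e: "{?a, ?b} = hedge x y" "{?b, ?c} = vedge (x + 1) y" "{?c, ?d} = hedge x (y + 1)" "{?d, ?a} = vedge x y"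
    by (auto simp: hedge_def vedge_def)
  have d: "diff {?a, ?b}" "diff {?b, ?c}" "diff {?c, ?d}" "diff {?d, ?a}"
    unfolding e using xy pos diff_hedge[of x] diff_vedge[of _ y] by simp_all
  have k: "corner ?a ?b ?d" "corner ?b ?a ?c" "corner ?c ?d ?b" "corner ?d ?c ?a"
    using grid_corner[of x y] grid_corner[of "x + 1" y] grid_corner[of "x + 1" "y + 1"]
      grid_corner[of x "y + 1"] xy pos by simp_all
  have k': "corner v p q \<Longrightarrow> corner v q p" for v p q unfolding corner_def by blast
  have cnt: "of_bool ({?a, ?b} \<in> C) + of_bool ({?b, ?c} \<in> C) + of_bool ({?c, ?d} \<in> C) + of_bool ({?d, ?a} \<in> C) = (2 :: nat)"
    using grid_block_count[OF xy] unfolding e cell_count_def by simp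
  let ?\<beta> = "inside C x y"
  have \<beta>': "inside C' x y \<longleftrightarrow> \<not> ?\<beta>" using inside_twin[of x y] xy by simp
  have o: "oriented C ?a ?b \<longleftrightarrow> {?a, ?b} \<in> C \<and> ?\<beta>" "oriented C ?b ?c \<longleftrightarrow> {?b, ?c} \<in> C \<and> ?\<beta>"
    "oriented C ?c ?d \<longleftrightarrow> {?c, ?d} \<in> C \<and> ?\<beta>" "oriented C ?d ?a \<longleftrightarrow> {?d, ?a} \<in> C \<and> ?\<beta>"
    unfolding e by (simp_all add: oriented_unit)
  have o': "oriented C' ?a ?b \<longleftrightarrow> {?a, ?b} \<in> C' \<and> \<not> ?\<beta>" "oriented C' ?b ?c \<longleftrightarrow> {?b, ?c} \<in> C' \<and> \<not> ?\<beta>"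
    "oriented C' ?c ?d \<longleftrightarrow> {?c, ?d} \<in> C' \<and> \<not> ?\<beta>" "oriented C' ?d ?a \<longleftrightarrow> {?d, ?a} \<in> C' \<and> \<not> ?\<beta>"
    unfolding e by (simp_all add: oriented_unit \<beta>')
  have step: "boundary_step u w" if "?\<beta>" "diff {u, w}" "oriented C u w \<longleftrightarrow> {u, w} \<in> C \<and> ?\<beta>"
      "oriented C' u w \<longleftrightarrow> {u, w} \<in> C' \<and> \<not> ?\<beta>" for u w
    using that oriented_flip[OF cyc', of u w] unfolding boundary_step_def diff_def by blast
  have step': "boundary_step w u" if "\<not> ?\<beta>" "diff {u, w}" "oriented C u w \<longleftrightarrow> {u, w} \<in> C \<and> ?\<beta>"
      "oriented C' u w \<longleftrightarrow> {u, w} \<in> C' \<and> \<not> ?\<beta>" for u w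
    using that oriented_flip[OF cyc, of u w] unfolding boundary_step_def diff_def insert_commute[of w u]
    by blast
  \<comment> \<open>The corners are taken anticlockwise if the block is inside \<open>C\<close> and
    clockwise otherwise, so that edges of \<open>C\<close> point forwards.\<close>
  show ?thesis
  proof (cases ?\<beta>)
    case True
    have "block ?a ?b ?c ?d" unfolding block_def
      using step[OF True] d o o' k k' by auto
    then show ?thesis using cnt by (rule block_signs)
  next
    case False
    have "block ?a ?d ?c ?b" unfolding block_def
      using step'[OF False] d o o' k k' by auto
    moreover have "of_bool ({?a, ?d} \<in> C) + of_bool ({?d, ?c} \<in> C) + of_bool ({?c, ?b} \<in> C) + of_bool ({?b, ?a} \<in> C) = (2 :: nat)"
      using cnt by (simp add: insert_commute)
    ultimately have "block_signs {?a, ?d, ?c, ?b}" by (rule block_signs)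
    moreover have "{?a, ?d, ?c, ?b} = {?a, ?b, ?c, ?d}" by auto
    ultimately show ?thesis by simp
  qed
qed

lemma even_number_of_blocks:
  assumes "sign \<sigma> = -1" "sign \<sigma>' = -1" "even (card (\<Union> C))"
  shows "even ((m div 2) * (n div 2))"
proof -
  define I where "I = {..<m div 2} \<times> {..<n div 2}"
  define B where "B = (\<lambda>(i, j). {(2*i+1 :: nat, 2*j+1 :: nat), (2*i+1+1, 2*j+1), (2*i+1+1, 2*j+1+1), (2*i+1, 2*j+1+1)})"
  have fin: "finite I" "\<And>k. finite (B k)" unfolding I_def B_def by (auto split: prod.splits)
  have signs: "block_signs (B k)" if "k \<in> I" for k
  proof -
    obtain i j where k: "k = (i, j)" by (cases k)
    have "2*i+1 < m" "2*j+1 < n" using that ev unfolding k I_def by auto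
    then show ?thesis unfolding k B_def prod.case by (intro grid_block_signs) simp_all
  qed
  have disj: "B k \<inter> B l = {}" if "k \<noteq> l" for k l
  proof -
    have "((fst v - 1) div 2, (snd v - 1) div 2) = k" if "v \<in> B k" for v k
      using that unfolding B_def by (auto split: prod.splits)
    then show ?thesis using \<open>k \<noteq> l\<close> by blast
  qed
  have UN: "(\<Union>k\<in>I. B k) = grid_vertices m n"
  proof
    show "(\<Union>k\<in>I. B k) \<subseteq> grid_vertices m n"
      unfolding I_def B_def grid_vertices_def using ev by auto
    show "grid_vertices m n \<subseteq> (\<Union>k\<in>I. B k)"
    proof
      fix v assume "v \<in> grid_vertices m n"
      then obtain x y where v: "v = (Suc x, Suc y)" "Suc x \<le> m" "Suc y \<le> n"
        unfolding grid_vertices_def by (auto simp: Suc_le_eq gr0_conv_Suc)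
      \<comment> \<open>Vertex coordinates start at 1 and block indices at 0; evenness of
        \<open>m\<close> and \<open>n\<close> keeps the index in range.\<close>
      have "(x div 2, y div 2) \<in> I" unfolding I_def using v ev by auto
      moreover have "v \<in> B (x div 2, y div 2)"
        unfolding B_def v by (simp, presburger)
      ultimately show "v \<in> (\<Union>k\<in>I. B k)" by blast
    qed
  qed
  have finV: "finite (grid_vertices m n)" unfolding grid_vertices_def by simp
  have C: "\<Union> C \<subseteq> grid_vertices m n" "\<Union> C' \<subseteq> grid_vertices m n"
    using Union_grid_edges sub sub' by blast+
  have p: "\<sigma> permutes grid_vertices m n" "\<sigma>' permutes grid_vertices m n"
    using perm perm' C permutes_subset by blast+
  then have "\<pi> permutes grid_vertices m n" unfolding \<pi>_def
    using permutes_compose permutes_inv by blast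
  then have "sign_on (grid_vertices m n) \<pi> = sign \<pi>" by (rule sign_on_permutes) simp
  also have "\<dots> = sign \<sigma>' * sign (inv \<sigma>)"
    unfolding \<pi>_def using p finV by (intro sign_compose) (auto intro: permutes_imp_permutation permutes_inv)
  also have "\<dots> = 1"
    using assms(1,2) sign_inverse[OF permutes_imp_permutation[OF finV p(1)]] by simp
  finally have prod: "(\<Prod>k\<in>I. sign_on (B k) \<pi>) = 1"
    using sign_on_UN[OF fin(1), of B \<pi>] fin(2) signs disj unfolding UN[symmetric] block_signs_def by simp
  \<comment> \<open>The blocks with opposite edges. The sign of \<open>\<pi>\<close> makes their
    number even, and the even length of \<open>C\<close> does the same for the remaining
    blocks.\<close>
  define N where "N = {k \<in> I. sign_on (B k) \<pi> = -1}"
  have "(\<Prod>k\<in>I. sign_on (B k) \<pi>) = (\<Prod>k\<in>I. if k \<in> N then -1 else 1)"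
    using signs by (intro prod.cong) (auto simp: N_def block_signs_def)
  also have "\<dots> = (-1) ^ card N"
    using fin(1) by (subst prod.If_cases) (auto simp: N_def Int_def)
  finally have N: "even (card N)" using prod by (cases "even (card N)") auto
  have "card (\<Union> C) = card (\<Union>k\<in>I. B k \<inter> \<Union> C)"
    using C(1) UN by (intro arg_cong[of _ _ card]) blast
  also have "\<dots> = (\<Sum>k\<in>I. card (B k \<inter> \<Union> C))"
    using fin disj by (intro card_UN_disjoint) blast+
  also have "\<dots> = (\<Sum>k\<in>I. if k \<in> N then 4 else 3)"
  proof (intro sum.cong refl)
    fix k assume k: "k \<in> I"
    from signs[OF k] show "card (B k \<inter> \<Union> C) = (if k \<in> N then 4 else 3)"
      unfolding block_signs_def N_def using k by auto
  qed
  also have "\<dots> = 4 * card N + 3 * card (I - N)"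
    using fin(1) by (subst sum.If_cases) (auto simp: N_def Int_def set_diff_eq intro!: arg_cong[of _ _ card])
  finally have "even (card (I - N))" using assms(3) by simp
  moreover have "card I = card N + card (I - N)"
    using fin(1) card_Un_disjoint[of N "I - N"] by (simp add: N_def Un_absorb1 card_Diff_subset card_mono)
  ultimately have "even (card I)" using N by simp
  then show ?thesis unfolding I_def by simp
qed

end

section \<open>Uniqueness in the remaining cases, and the equivalences\<close>

context signature_twins
begin

text \<open>The block at \<open>(1, 1)\<close> has at least two corners that are corners of the
  grid, where the two edges are both in \<open>C\<close> or both not. So three of its sides agree,
  and \<open>C\<close> cannot contain exactly two of the four.\<close>

lemma eq_if_thin:
  assumes gcd: "gcd m n = 2" and thin: "m = 2 \<or> n = 2"
  shows "C = C'"
proof (rule ccontr)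
  assume "C \<noteq> C'"
  note blocks = diff_blocks_if_gcd_2[OF gcd this]
  have mn2: "2 \<le> m" "2 \<le> n" using gcd mn by (metis gcd_dvd1 gcd_dvd2 dvd_imp_le)+
  have out: "hedge 0 y \<notin> C" "vedge x 0 \<notin> C" "hedge m y \<notin> C" "vedge x n \<notin> C" for x y
    using hedge_bounds[OF sub, of 0 y] hedge_bounds[OF sub, of m y]
      vedge_bounds[OF sub, of x 0] vedge_bounds[OF sub, of x n] by auto
  have vc: "vertex_count C x y \<in> {0, 2}" if "1 \<le> x" "1 \<le> y" for x y
    using vertex_count_cycle[OF cyc that] by simp
  have eq: "P = Q" if "of_bool P + of_bool Q \<in> {0, 2 :: nat}" for P Q
    using that by (cases P; cases Q) auto
  have "vertex_count C 1 1 = of_bool (hedge 1 1 \<in> C) + of_bool (vedge 1 1 \<in> C)"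
    using out(1)[of 1] out(2)[of 1] by (simp add: vertex_count_def)
  then have hv: "hedge 1 1 \<in> C \<longleftrightarrow> vedge 1 1 \<in> C" using eq vc[of 1 1] by simp
  have third: "(hedge 1 1 \<in> C \<longleftrightarrow> vedge 2 1 \<in> C) \<or> (vedge 1 1 \<in> C \<longleftrightarrow> hedge 1 2 \<in> C)"
    using thin
  proof
    assume "m = 2"
    then have "vertex_count C 2 1 = of_bool (hedge 1 1 \<in> C) + of_bool (vedge 2 1 \<in> C)"
      using out(3)[of 1] out(2)[of 2] by (simp add: vertex_count_def)
    then show ?thesis using eq vc[of 2 1] by simp
  next
    assume "n = 2"
    then have "vertex_count C 1 2 = of_bool (vedge 1 1 \<in> C) + of_bool (hedge 1 2 \<in> C)"
      using out(1)[of 2] out(4)[of 1] by (simp add: vertex_count_def)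
    then show ?thesis using eq vc[of 1 2] by simp
  qed
  have "diff (hedge 1 1)" "diff (hedge 1 2)" "diff (vedge 1 1)" "diff (vedge 2 1)"
    using blocks mn2 by simp_all
  moreover have "cell_count C 1 1 = cell_count C' 1 1"
    using sig mn2 unfolding signature_eq_iff by simp
  ultimately have "cell_count C 1 1 = 2"
    unfolding cell_count_def diff_def one_add_one by (auto simp: of_bool_def split: if_splits)
  then show False using hv third unfolding cell_count_def one_add_one
    by (auto simp: of_bool_def split: if_splits)
qed

lemma eq_if_both_2_mod_4:
  assumes gcd: "gcd m n = 2" and mod: "m mod 4 = 2" "n mod 4 = 2"
  shows "C = C'"
proof (rule ccontr)
  assume "C \<noteq> C'"
  note blocks = diff_blocks_if_gcd_2[OF gcd this]
  obtain \<sigma> where s: "\<sigma> permutes \<Union> C" "\<And>v. v \<in> \<Union> C \<Longrightarrow> oriented C v (\<sigma> v)" "sign \<sigma> = -1" "even (card (\<Union> C))"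
    using oriented_permutation[OF cyc] by metis
  obtain \<sigma>' where s': "\<sigma>' permutes \<Union> C'" "\<And>v. v \<in> \<Union> C' \<Longrightarrow> oriented C' v (\<sigma>' v)" "sign \<sigma>' = -1"
    using oriented_permutation[OF cyc'] by metis
  have ev: "even m" "even n" using mod by presburger+
  interpret block_twins m n C C' \<sigma> \<sigma>'
    using s(1,2) s'(1,2) ev blocks by unfold_locales
  have "even ((m div 2) * (n div 2))" by (rule even_number_of_blocks) (use s s' in auto)
  moreover have "odd (m div 2)" "odd (n div 2)" using mod by presburger+
  ultimately show False by simp
qed

end

lemma signature_determines_cycle:
  assumes mn: "m > 0" "n > 0"
    and cond: "m \<le> 2 \<or> n \<le> 2 \<or> gcd m n = 1 \<or> gcd m n = 2 \<and> m mod 4 = 2 \<and> n mod 4 = 2"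
    and "is_cycle (grid_edges m n) C" "is_cycle (grid_edges m n) C'" "signature m n C = signature m n C'"
  shows "C = C'"
proof -
  interpret signature_twins m n C C' using assms by unfold_locales
  \<comment> \<open>Thin grids fall under the coprime case, except when a side is 2 and the other is
    even.\<close>
  have "gcd m n = 1 \<or> gcd m n = 2 \<and> (m = 2 \<or> n = 2)" if "m \<le> 2 \<or> n \<le> 2"
  proof -
    have two: "gcd 2 k = 1 \<or> gcd 2 k = 2" for k :: nat
      by (cases "even k") (auto simp: gcd_nat.absorb1 coprime_iff_gcd_eq_1[symmetric])
    have "m = 1 \<or> n = 1 \<or> m = 2 \<or> n = 2" using that mn by linarith
    then show ?thesis using two[of n] two[of m] gcd.commute[of m n] by auto
  qed
  then show ?thesis using cond eq_if_coprime eq_if_thin eq_if_both_2_mod_4 by metis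
qed

theorem theorem4:
  fixes m n d :: nat
  assumes "m > 0" and "n > 0" and "d = gcd m n"
  shows
    "((\<forall>C C'. is_cycle (grid_edges m n) C \<longrightarrow> is_cycle (grid_edges m n) C' \<longrightarrow>
          signature m n C = signature m n C' \<longrightarrow> C = C')
       \<longleftrightarrow>
       (m \<le> 2 \<or> n \<le> 2) \<or>
       d = 1 \<or>
       (d = 2 \<and> [m = n] (mod 4) \<and> [n = 2] (mod 4)))
     \<and>
     ((\<exists>C C'. is_cycle (grid_edges m n) C \<and> is_cycle (grid_edges m n) C' \<and>
          C \<noteq> C' \<and> signature m n C = signature m n C')
       \<longleftrightarrow>
       (m \<ge> 3 \<and> n \<ge> 3) \<and>
       d \<ge> 2 \<and>
       (d = 2 \<longrightarrow> [m = 0] (mod 4) \<or> [n = 0] (mod 4)))"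
proof -
  let ?unique = "(m \<le> 2 \<or> n \<le> 2) \<or> d = 1 \<or> (d = 2 \<and> [m = n] (mod 4) \<and> [n = 2] (mod 4))"
  let ?ambiguous = "(m \<ge> 3 \<and> n \<ge> 3) \<and> d \<ge> 2 \<and> (d = 2 \<longrightarrow> [m = 0] (mod 4) \<or> [n = 0] (mod 4))"
  have d: "d > 0" "d dvd m" "d dvd n" using assms by simp_all
  have cong4: "[m = n] (mod 4) \<and> [n = 2] (mod 4) \<longleftrightarrow> m mod 4 = 2 \<and> n mod 4 = 2"
    "[m = 0] (mod 4) \<longleftrightarrow> 4 dvd m" "[n = 0] (mod 4) \<longleftrightarrow> 4 dvd n"
    by (auto simp: cong_def)
  have mod4: "\<not> (m mod 4 = 2 \<and> n mod 4 = 2) \<longleftrightarrow> 4 dvd m \<or> 4 dvd n" if "d = 2"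
  proof -
    have "even m" "even n" using d that by simp_all
    then show ?thesis by presburger
  qed
  \<comment> \<open>The two conditions are complementary, so uniqueness under one and existence
    under the other give both equivalences.\<close>
  have compl: "?ambiguous \<longleftrightarrow> \<not> ?unique"
    unfolding cong4 using mod4 d(1) by (cases "d = 2") auto
  have unique: "C = C'" if ?unique "is_cycle (grid_edges m n) C" "is_cycle (grid_edges m n) C'"
      "signature m n C = signature m n C'" for C C'
  proof (rule signature_determines_cycle[OF assms(1,2) _ that(2-4)])
    show "m \<le> 2 \<or> n \<le> 2 \<or> gcd m n = 1 \<or> gcd m n = 2 \<and> m mod 4 = 2 \<and> n mod 4 = 2"
      using that(1) unfolding cong4(1) assms(3) by simp
  qed
  have ex: "\<exists>C C'. is_cycle (grid_edges m n) C \<and> is_cycle (grid_edges m n) C' \<and>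
      C \<noteq> C' \<and> signature m n C = signature m n C'" if ?ambiguous
    using that ambiguous_pair_exists[of m n] assms(3) cong4 unfolding ambiguous_pair_def by metis
  show ?thesis using compl unique ex by blast
qed

end
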